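(* Let $\mathfrak X$ be a real separable M-type 2 Banach space and let $\{F_t,\mathcal F_t: t\in[0,T]\}\in\mathscr M$ be a set-valued stochastic process. Then both $\{J_t(F)\}$ and $\{I_t(F)\}$, where $J_t(F)=\int_0^{t+}\int_Z F_s(z)N(ds\,dz)$ and $I_t(F)=\int_0^{t+}\int_Z F_s(z)\tilde N(ds\,dz)$, are $L^2$-integrably bounded, i.e. $\|J_t(F)\|_{\mathbf K}\in L^2(\Omega;\mathbb R)$ and $\|I_t(F)\|_{\mathbf K}\in L^2(\Omega;\mathbb R)$ for every $t\in[0,T]$.
   Context: Setting. $(\Omega,\mathcal F,\{\mathcal F_t\}_{t\ge0},P)$ is a complete filtered probability space satisfying the usual conditions. $(\mathfrak X,\|\cdot\|)$ is a real separable Banach space, and $\mathbf K(\mathfrak X)$ is the family of nonempty closed subsets of $\mathfrak X$. $\mathfrak X$ is of M-type 2 if there is a constant $C_{\mathfrak X}>0$ such that $\sup_k E\|M_k\|^2\le C_{\mathfrak X}\sum_k E\|M_k-M_{k-1}\|^2$ for every $\mathfrak X$-valued martingale $\{M_k\}$. $Z$ is a separable Banach space with Borel $\sigma$-algebra $\mathcal B(Z)$, $\nu$ is a finite measure on $(Z,\mathcal B(Z))$, and $T>0$. $\mathbf p$ is an $\{\mathcal F_t\}$-adapted stationary Poisson point process on $Z$ with characteristic measure $\nu$; $N(dt\,dz)$ is its Poisson random (counting) measure on $[0,T]\times Z$, with intensity $dt\,\nu(dz)$, and $\tilde N(dt\,dz)=N(dt\,dz)-dt\,\nu(dz)$ is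 the compensated measure, $\tilde N((0,t],U)$ being an $\{\mathcal F_t\}$-martingale for each $U\in\mathcal B(Z)$. Set-valued random variables. $F:\Omega\to\mathbf K(\mathfrak X)$ is measurable if $\{\omega:F(\omega)\cap O\ne\emptyset\}\in\mathcal F$ for every open $O\subset\mathfrak X$; measurability with respect to other $\sigma$-algebras is defined likewise. $\|A\|_{\mathbf K}=\sup_{a\in A}\|a\|$. $S^p_F(\mathcal G)$ is the set of $f\in L^p(\Omega,\mathcal G,P;\mathfrak X)$ with $f(\omega)\in F(\omega)$ a.s. Integrands. $\mathscr S$ is the smallest $\sigma$-algebra on $[0,T]\times Z\times\Omega$ making measurable all $g:[0,T]\times Z\times\Omega\to\mathfrak X$ such that $(z,\omega)\mapsto g(t,z,\omega)$ is $\mathcal B(Z)\otimes\mathcal F_t$-measurable for each $t$ and $t\mapsto g(t,z,\omega)$ is left continuous for each $(z,\omega)$. $\mathscr L$ is the set of $\mathscr S$-measurable ($\mathscr S$-predictable) $f:[0,T]\times Z\times\Omega\to\mathfrak X$ with $E\int_0^T\int_Z\|f_t(z)\|^2\nu(dz)dt<\infty$. $\mathscr M$ is the set of $\mathscr S$-measurable $F:[0,T]\times Z\times\Omega\to\mathbf K(\mathfrak X)$ with $E\int_0^T\int_Z\|F_t(z)\|^2_{\mathbf K}\,dt\,\nu(dz)<\infty$. Here $f_t(z)=f(t,z,\omega)$, $F_t(z)=F(t,z,\omega)$. $S(F)=\{f\in\mathscr L: f(t,z,\omega)\in F(t,z,\omega)\text{ for a.e. }(t,z,\omega)\}$. Integrals.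 For $f\in\mathscr L$, $\int_0^{t+}\int_Z f_s(z)N(ds\,dz)$ is the integral over $(0,t]\times Z$ (a.s. a finite sum), and $\int_0^{t+}\int_Z f_s(z)\tilde N(ds\,dz)=\int_0^{t+}\int_Z f_s(z)N(ds\,dz)-\int_0^t\int_Z f_s(z)\,ds\,\nu(dz)$. For $F\in\mathscr M$, put $\tilde\Gamma_t=\{\int_0^{t+}\int_Z f_s(z)\tilde N(ds\,dz): f\in S(F)\}$ and $\Gamma_t=\{\int_0^{t+}\int_Z f_s(z)N(ds\,dz): f\in S(F)\}$. The decomposable hull of a set $\Gamma$ of random variables with respect to $\mathcal F_t$ is $de\,\Gamma=\{\sum_{i=1}^m\chi_{A_i}g_i: m\ge1,\ \{A_i\}\text{ a finite }\mathcal F_t\text{-measurable partition of }\Omega,\ g_i\in\Gamma\}$; $\overline{de}\,\Gamma$ is its closure in $L^1(\Omega;\mathfrak X)$. $I_t(F)$ and $J_t(F)$ are the $\mathcal F_t$-measurable $\mathbf K(\mathfrak X)$-valued random variables (unique a.s.) with $S^1_{I_t(F)}(\mathcal F_t)=\overline{de}\,\tilde\Gamma_t$ and $S^1_{J_t(F)}(\mathcal F_t)=\overline{de}\,\Gamma_t$. *)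

theory Defs
  imports "HOL-Probability.Probability"
begin

section \<open>Filtrations and martingales\<close>

text \<open>The index set is explicit because continuous time is \<open>{0..}\<close> or \<open>{0..T}\<close>, whereas
  \<^locale>\<open>filtration\<close> is indexed by a whole type.\<close>

definition filtration_on :: "'w measure \<Rightarrow> 't::linorder set \<Rightarrow> ('t \<Rightarrow> 'w measure) \<Rightarrow> bool" where
  "filtration_on M I \<F> \<longleftrightarrow>
     (\<forall>t\<in>I. subalgebra M (\<F> t)) \<and> (\<forall>s\<in>I. \<forall>t\<in>I. s \<le> t \<longrightarrow> sets (\<F> s) \<subseteq> sets (\<F> t))"

text \<open>The last clause is \<open>E[X\<^sub>t | \<F>\<^sub>s] = X\<^sub>s\<close>, i.e. the defining property of the conditional
  expectation, as \<^const>\<open>real_cond_exp\<close> does not cover Banach-valued variables.\<close>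

definition martingale_on ::
  "'w measure \<Rightarrow> 't::linorder set \<Rightarrow> ('t \<Rightarrow> 'w measure) \<Rightarrow>
   ('t \<Rightarrow> 'w \<Rightarrow> 'x::{banach,second_countable_topology}) \<Rightarrow> bool" where
  "martingale_on M I \<F> X \<longleftrightarrow>
     (\<forall>t\<in>I. X t \<in> borel_measurable (\<F> t) \<and> integrable M (X t)) \<and>
     (\<forall>s\<in>I. \<forall>t\<in>I. s \<le> t \<longrightarrow>
        (\<forall>A\<in>sets (\<F> s). (LINT \<omega>:A|M. X t \<omega>) = (LINT \<omega>:A|M. X s \<omega>)))"

text \<open>Complete probability space with a filtration satisfying the usual conditions.\<close>

locale usual_filtered_prob_space = prob_space M + complete_measure M
  for M :: "'w measure" +
  fixes \<F> :: "real \<Rightarrow> 'w measure"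
  assumes filtration: "filtration_on M {0..} \<F>"
    and null_sets_initial: "null_sets M \<subseteq> sets (\<F> 0)"
    and right_continuous: "\<And>t. 0 \<le> t \<Longrightarrow> sets (\<F> t) = (\<Inter>u\<in>{t<..}. sets (\<F> u))"

text \<open>M-type 2, with the convention \<open>X\<^sub>-\<^sub>1 = 0\<close>. Moments are taken in \<^typ>\<open>ennreal\<close>, so no
  square integrability of the martingale is presupposed. HOL cannot quantify over sample space
  types; sample spaces carried by \<^typ>\<open>nat \<Rightarrow> 'x\<close> are no restriction, since the inequality
  depends only on the law of the path \<open>(X\<^sub>k)\<^sub>k\<close>, under which the coordinate process is a
  martingale for its own filtration.\<close>

definition M_type_2 :: "'x::{banach,second_countable_topology} itself \<Rightarrow> bool" where
  "M_type_2 X_type \<longleftrightarrow>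
     (\<exists>C::real. C > 0 \<and>
       (\<forall>(P :: (nat \<Rightarrow> 'x) measure) \<G> (X :: nat \<Rightarrow> (nat \<Rightarrow> 'x) \<Rightarrow> 'x).
          prob_space P \<longrightarrow> filtration_on P UNIV \<G> \<longrightarrow> martingale_on P UNIV \<G> X \<longrightarrow>
          (SUP k. \<integral>\<^sup>+\<omega>. ennreal ((norm (X k \<omega>))\<^sup>2) \<partial>P) \<le>
          ennreal C *
            (\<Sum>k. \<integral>\<^sup>+\<omega>. ennreal ((norm (X k \<omega> - (if k = 0 then 0 else X (k - 1) \<omega>)))\<^sup>2) \<partial>P)))"


section \<open>Poisson point processes\<close>

text \<open>A point function on \<open>Z\<close> is a partial map \<open>real \<rightharpoonup> Z\<close> with countable domain in \<open>(0,\<infinity>)\<close>;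
  its counting measure charges \<open>B\<close> with the number of \<open>s\<close> in the domain with \<open>(s, p s) \<in> B\<close>.\<close>

definition count_measure :: "('w \<Rightarrow> real \<rightharpoonup> 'z::topological_space) \<Rightarrow> 'w \<Rightarrow> (real \<times> 'z) measure" where
  "count_measure p \<omega> =
     distr (count_space (dom (p \<omega>))) (borel \<Otimes>\<^sub>M borel) (\<lambda>s. (s, the (p \<omega> s)))"

definition poisson_random_measure ::
  "'w measure \<Rightarrow> 'e measure \<Rightarrow> ('w \<Rightarrow> 'e measure) \<Rightarrow> 'e set \<Rightarrow> bool" where
  "poisson_random_measure M \<mu> N E \<longleftrightarrow>
     (\<forall>B\<in>sets \<mu>. B \<subseteq> E \<longrightarrow>
        (\<lambda>\<omega>. emeasure (N \<omega>) B) \<in> borel_measurable M \<and>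
        (emeasure \<mu> B < \<infinity> \<longrightarrow>
           (\<forall>k::nat. measure M {\<omega>\<in>space M. emeasure (N \<omega>) B = of_nat k} =
              measure \<mu> B ^ k / fact k * exp (- measure \<mu> B))) \<and>
        (emeasure \<mu> B = \<infinity> \<longrightarrow> (AE \<omega> in M. emeasure (N \<omega>) B = \<infinity>))) \<and>
     (\<forall>(n::nat) B. (\<forall>i<n. B i \<in> sets \<mu> \<and> B i \<subseteq> E) \<longrightarrow> disjoint_family_on B {..<n} \<longrightarrow>
        prob_space.indep_vars M (\<lambda>_. borel) (\<lambda>i \<omega>. emeasure (N \<omega>) (B i)) {..<n})"

text \<open>An adapted stationary Poisson point process with characteristic measure \<open>\<nu>\<close>:
  stationarity is the product form \<open>dt \<nu>(dz)\<close> of the intensity.\<close>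

definition stationary_poisson_point_process ::
  "'w measure \<Rightarrow> (real \<Rightarrow> 'w measure) \<Rightarrow> 'z::second_countable_topology measure \<Rightarrow>
   ('w \<Rightarrow> real \<rightharpoonup> 'z) \<Rightarrow> bool" where
  "stationary_poisson_point_process M \<F> \<nu> p \<longleftrightarrow>
     (\<forall>\<omega>\<in>space M. countable (dom (p \<omega>)) \<and> dom (p \<omega>) \<subseteq> {0<..}) \<and>
     poisson_random_measure M (lborel \<Otimes>\<^sub>M \<nu>) (count_measure p) ({0<..} \<times> UNIV) \<and>
     (\<forall>t\<ge>0. \<forall>U\<in>sets borel.
        (\<lambda>\<omega>. emeasure (count_measure p \<omega>) ({0<..t} \<times> U)) \<in> borel_measurable (\<F> t))"

definition compensated ::
  "('w \<Rightarrow> real \<rightharpoonup> 'z::topological_space) \<Rightarrow> 'z measure \<Rightarrow> 'z set \<Rightarrow> real \<Rightarrow> 'w \<Rightarrow> real" where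
  "compensated p \<nu> U t \<omega> = measure (count_measure p \<omega>) ({0<..t} \<times> U) - t * measure \<nu> U"


section \<open>Set-valued random variables\<close>

definition set_measurable :: "'a measure \<Rightarrow> ('a \<Rightarrow> 'x::topological_space set) \<Rightarrow> bool" where
  "set_measurable A F \<longleftrightarrow>
     (\<forall>x\<in>space A. F x \<noteq> {} \<and> closed (F x)) \<and>
     (\<forall>O'. open O' \<longrightarrow> {x\<in>space A. F x \<inter> O' \<noteq> {}} \<in> sets A)"

text \<open>Extended-valued, so that unbounded sets have norm \<open>\<infinity>\<close>.\<close>

definition normK :: "'x::real_normed_vector set \<Rightarrow> ennreal" where
  "normK A = (SUP a\<in>A. ennreal (norm a))"

definition L2_integrably_bounded ::
  "'w measure \<Rightarrow> ('w \<Rightarrow> 'x::real_normed_vector set) \<Rightarrow> bool" where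
  "L2_integrably_bounded M F \<longleftrightarrow>
     (\<lambda>\<omega>. normK (F \<omega>)) \<in> borel_measurable M \<and> (\<integral>\<^sup>+\<omega>. (normK (F \<omega>))\<^sup>2 \<partial>M) < \<infinity>"

text \<open>Elements of \<open>L\<^sup>1\<close> are represented by functions; the sets below are closed under changing
  a function on a null set (for the first one, if \<open>G\<close> contains the null sets).\<close>

definition selections1 ::
  "'w measure \<Rightarrow> 'w measure \<Rightarrow> ('w \<Rightarrow> 'x::{banach,second_countable_topology} set) \<Rightarrow> ('w \<Rightarrow> 'x) set" where
  "selections1 M G F =
     {f. f \<in> borel_measurable G \<and> integrable M f \<and> (AE \<omega> in M. f \<omega> \<in> F \<omega>)}"

definition L1_closure ::
  "'w measure \<Rightarrow> ('w \<Rightarrow> 'x::{banach,second_countable_topology}) set \<Rightarrow> ('w \<Rightarrow> 'x) set" where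
  "L1_closure M \<Gamma> =
     {h. integrable M h \<and>
         (\<forall>e>0. \<exists>g\<in>\<Gamma>. integrable M g \<and> (LINT \<omega>|M. norm (g \<omega> - h \<omega>)) < e)}"

definition decomposable_hull :: "'w measure \<Rightarrow> ('w \<Rightarrow> 'x::real_vector) set \<Rightarrow> ('w \<Rightarrow> 'x) set" where
  "decomposable_hull G \<Gamma> =
     {(\<lambda>\<omega>. \<Sum>i=1..m. indicator (A i) \<omega> *\<^sub>R g i \<omega>) | (m::nat) A g.
        m \<ge> 1 \<and> (\<forall>i\<in>{1..m}. A i \<in> sets G \<and> g i \<in> \<Gamma>) \<and>
        disjoint_family_on A {1..m} \<and> (\<Union>i\<in>{1..m}. A i) = space G}"


section \<open>Integrands\<close>

text \<open>The \<open>\<sigma>\<close>-algebra \<open>\<S>\<close>; the type argument is the value space of the generating functions.\<close>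

definition left_continuous_adapted ::
  "'w measure \<Rightarrow> (real \<Rightarrow> 'w measure) \<Rightarrow> real \<Rightarrow>
   (real \<times> 'z::topological_space \<times> 'w \<Rightarrow> 'x::topological_space) \<Rightarrow> bool" where
  "left_continuous_adapted M \<F> T g \<longleftrightarrow>
     (\<forall>t\<in>{0..T}. (\<lambda>(z, \<omega>). g (t, z, \<omega>)) \<in> borel_measurable (borel \<Otimes>\<^sub>M \<F> t)) \<and>
     (\<forall>z. \<forall>\<omega>\<in>space M. \<forall>t\<in>{0<..T}. continuous (at_left t) (\<lambda>s. g (s, z, \<omega>)))"

definition pred_sigma ::
  "'x::topological_space itself \<Rightarrow> 'w measure \<Rightarrow> (real \<Rightarrow> 'w measure) \<Rightarrow> real \<Rightarrow>
   (real \<times> 'z::topological_space \<times> 'w) measure" where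
  "pred_sigma X_type M \<F> T =
     sigma ({0..T} \<times> UNIV \<times> space M)
       {g -` B \<inter> ({0..T} \<times> UNIV \<times> space M) |
          (g :: real \<times> 'z \<times> 'w \<Rightarrow> 'x) B. left_continuous_adapted M \<F> T g \<and> B \<in> sets borel}"

definition sq_energy ::
  "'w measure \<Rightarrow> 'z measure \<Rightarrow> real \<Rightarrow> (real \<times> 'z \<times> 'w \<Rightarrow> ennreal) \<Rightarrow> ennreal" where
  "sq_energy M \<nu> T h =
     (\<integral>\<^sup>+\<omega>. (\<integral>\<^sup>+t\<in>{0..T}. (\<integral>\<^sup>+z. (h (t, z, \<omega>))\<^sup>2 \<partial>\<nu>) \<partial>lborel) \<partial>M)"

definition integrands ::
  "'w measure \<Rightarrow> (real \<Rightarrow> 'w measure) \<Rightarrow> 'z::second_countable_topology measure \<Rightarrow> real \<Rightarrow>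
   (real \<times> 'z \<times> 'w \<Rightarrow> 'x::{banach,second_countable_topology}) set" where
  "integrands M \<F> \<nu> T =
     {f. f \<in> borel_measurable (pred_sigma TYPE('x) M \<F> T) \<and>
         sq_energy M \<nu> T (\<lambda>x. ennreal (norm (f x))) < \<infinity>}"

definition set_integrands ::
  "'w measure \<Rightarrow> (real \<Rightarrow> 'w measure) \<Rightarrow> 'z::second_countable_topology measure \<Rightarrow> real \<Rightarrow>
   (real \<times> 'z \<times> 'w \<Rightarrow> 'x::{banach,second_countable_topology} set) set" where
  "set_integrands M \<F> \<nu> T =
     {F. set_measurable (pred_sigma TYPE('x) M \<F> T) F \<and>
         sq_energy M \<nu> T (\<lambda>x. normK (F x)) < \<infinity>}"

definition integrand_selections ::
  "'w measure \<Rightarrow> (real \<Rightarrow> 'w measure) \<Rightarrow> 'z::second_countable_topology measure \<Rightarrow> real \<Rightarrow>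
   (real \<times> 'z \<times> 'w \<Rightarrow> 'x::{banach,second_countable_topology} set) \<Rightarrow>
   (real \<times> 'z \<times> 'w \<Rightarrow> 'x) set" where
  "integrand_selections M \<F> \<nu> T F =
     {f \<in> integrands M \<F> \<nu> T.
        AE x in restrict_space lborel {0..T} \<Otimes>\<^sub>M (\<nu> \<Otimes>\<^sub>M M). f x \<in> F x}"


section \<open>Stochastic integrals\<close>

definition N_integral ::
  "('w \<Rightarrow> real \<rightharpoonup> 'z::topological_space) \<Rightarrow> (real \<times> 'z \<times> 'w \<Rightarrow> 'x::{banach,second_countable_topology}) \<Rightarrow>
   real \<Rightarrow> 'w \<Rightarrow> 'x" where
  "N_integral p f t \<omega> = (LINT (s, z):{0<..t} \<times> UNIV|count_measure p \<omega>. f (s, z, \<omega>))"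

definition N_comp_integral ::
  "('w \<Rightarrow> real \<rightharpoonup> 'z::topological_space) \<Rightarrow> 'z measure \<Rightarrow>
   (real \<times> 'z \<times> 'w \<Rightarrow> 'x::{banach,second_countable_topology}) \<Rightarrow> real \<Rightarrow> 'w \<Rightarrow> 'x" where
  "N_comp_integral p \<nu> f t \<omega> =
     N_integral p f t \<omega> - (LINT (s, z):{0<..t} \<times> UNIV|lborel \<Otimes>\<^sub>M \<nu>. f (s, z, \<omega>))"

text \<open>The set-valued integrals are determined only up to almost sure equality by their
  integrable selections, so being a version of \<open>J\<^sub>t(F)\<close> or \<open>I\<^sub>t(F)\<close> is a predicate.\<close>

definition is_J ::
  "'w measure \<Rightarrow> (real \<Rightarrow> 'w measure) \<Rightarrow> 'z::second_countable_topology measure \<Rightarrow> real \<Rightarrow>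
   ('w \<Rightarrow> real \<rightharpoonup> 'z) \<Rightarrow> (real \<times> 'z \<times> 'w \<Rightarrow> 'x::{banach,second_countable_topology} set) \<Rightarrow>
   real \<Rightarrow> ('w \<Rightarrow> 'x set) \<Rightarrow> bool" where
  "is_J M \<F> \<nu> T p F t J \<longleftrightarrow>
     set_measurable (\<F> t) J \<and>
     selections1 M (\<F> t) J =
       L1_closure M (decomposable_hull (\<F> t)
         ((\<lambda>f. N_integral p f t) ` integrand_selections M \<F> \<nu> T F))"

definition is_I ::
  "'w measure \<Rightarrow> (real \<Rightarrow> 'w measure) \<Rightarrow> 'z::second_countable_topology measure \<Rightarrow> real \<Rightarrow>
   ('w \<Rightarrow> real \<rightharpoonup> 'z) \<Rightarrow> (real \<times> 'z \<times> 'w \<Rightarrow> 'x::{banach,second_countable_topology} set) \<Rightarrow>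
   real \<Rightarrow> ('w \<Rightarrow> 'x set) \<Rightarrow> bool" where
  "is_I M \<F> \<nu> T p F t I \<longleftrightarrow>
     set_measurable (\<F> t) I \<and>
     selections1 M (\<F> t) I =
       L1_closure M (decomposable_hull (\<F> t)
         ((\<lambda>f. N_comp_integral p \<nu> f t) ` integrand_selections M \<F> \<nu> T F))"

end

theory Submission
  imports Defs
begin

text \<open>
  Both set-valued integrals are dominated by one real random variable. Put
  \<open>\<phi> = \<parallel>F\<parallel>\<close> (the extended real function \<^const>\<open>normK\<close> of \<open>F\<close>), a nonnegative predictable function with
  finite energy, and
  \<open>R = \<integral>\<^sub>0\<^sup>T \<integral> \<phi> dN + \<integral>\<^sub>0\<^sup>T \<integral> \<phi> dt d\<nu>\<close>.
  Since a path of \<open>N\<close> has almost surely finitely many points up to \<open>T\<close>, the integral against \<open>N\<close>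
  of a selection \<open>f\<close> of \<open>F\<close> is a finite sum, so the triangle inequality bounds it and its compensated version by \<open>R\<close>.
  The bound survives decomposable hulls and \<open>L\<^sup>1\<close> limits
  (\<open>decomposable_hull_bound\<close>, \<open>L1_closure_bound\<close>), so that \<open>R\<close> bounds every integrable
  selection of \<open>J\<^sub>t(F)\<close> and of \<open>I\<^sub>t(F)\<close>. It remains to see that these sets are then bounded by \<open>R\<close>,
  and that \<open>R\<close> is square integrable.

  The first point needs enough selections. The theorem of Kuratowski and Ryll-Nardzewski gives
  one selection of \<open>F\<close>, so that the set of integrals is not empty, and it gives selections of \<open>J\<^sub>t(F)\<close> inside
  any ball on the event that the ball is hit. Countably many balls then suffice
  (\<open>normK_bound_of_selections\<close>).

  The second point rests on Campbell's formula \<open>E \<integral> h dN = E \<integral>\<integral> h dt d\<nu>\<close> for predictable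
  \<open>h \<ge> 0\<close> (\<open>Campbell\<close>), obtained from the martingale property of the compensated measure on rectangles by a
  monotone class argument. It is also the reason why the almost everywhere relation
  \<open>\<parallel>f\<parallel> \<le> \<phi>\<close> holds at the random points of \<open>N\<close> (\<open>domination_transfer\<close>).
  For the second moment of \<open>Y\<^sub>t = \<integral>\<^sub>0\<^sup>t \<integral> \<phi> dN\<close>, the square telescopes over the points,
  \<open>Y\<^sub>T\<^sup>2 = \<integral>\<^sub>0\<^sup>T \<integral> (2 Y\<^sub>s\<^sub>- \<phi> + \<phi>\<^sup>2) dN\<close>,
  where the left limit \<open>Y\<^sub>s\<^sub>-\<close> is predictable. Campbell's formula turns the right-hand side into
  an integral against \<open>dt d\<nu>\<close>. There \<open>2 Y\<^sub>s\<^sub>- \<phi> \<le> Y\<^sub>T\<^sup>2/c + c \<phi>\<^sup>2\<close>; with \<open>c\<close> at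
  least twice the total mass \<open>T \<nu>(Z)\<close> the first term contributes at most half of
  \<open>E Y\<^sub>T\<^sup>2\<close>, and can be absorbed. Truncating \<open>Y\<close> at a constant makes the absorbed quantity
  finite (\<open>truncated_second_moment\<close>). The drift is handled by the Cauchy-Schwarz inequality.
\<close>


section \<open>Measurable selections\<close>

lemma normK_upper: "x \<in> A \<Longrightarrow> ennreal (norm x) \<le> normK A"
  unfolding normK_def by (rule SUP_upper)

lemma normK_le_iff: "normK A \<le> c \<longleftrightarrow> (\<forall>x\<in>A. ennreal (norm x) \<le> c)"
  unfolding normK_def by (rule SUP_le_iff)

lemma normK_measurable:
  fixes F :: "'a \<Rightarrow> 'x::real_normed_vector set"
  assumes "set_measurable A F"
  shows "(\<lambda>x. normK (F x)) \<in> borel_measurable A"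
proof (rule borel_measurableI_greater)
  fix y :: ennreal
  have op: "open {a::'x. y < ennreal (norm a)}"
    by (intro open_Collect_less continuous_on_ennreal continuous_intros)
  have "{x \<in> space A. y < normK (F x)} = {x \<in> space A. F x \<inter> {a. y < ennreal (norm a)} \<noteq> {}}"
    unfolding normK_def less_SUP_iff by auto
  also have "\<dots> \<in> sets A" using assms op unfolding set_measurable_def by blast
  finally show "{x \<in> space A. y < normK (F x)} \<in> sets A" .
qed

text \<open>A sequence rather than a countable dense set: selections are built by taking the least index that works.\<close>

lemma dense_sequence_exists:
  obtains d :: "nat \<Rightarrow> 'x::{metric_space, second_countable_topology}"
  where "\<And>U. open U \<Longrightarrow> U \<noteq> {} \<Longrightarrow> \<exists>k. d k \<in> U"
proof -
  obtain D :: "'x set" where D: "countable D" "\<And>X. open X \<Longrightarrow> X \<noteq> {} \<Longrightarrow> \<exists>d\<in>D. d \<in> X"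
    using countable_dense_exists by blast
  from D(2)[OF open_UNIV] have "D \<noteq> {}" by auto
  then have r: "range (from_nat_into D) = D" using D(1) by (rule range_from_nat_into)
  show ?thesis
  proof (rule that)
    fix U :: "'x set" assume U: "open U" "U \<noteq> {}"
    obtain e where "e \<in> D" "e \<in> U" using D(2)[OF U] by blast
    then show "\<exists>k. from_nat_into D k \<in> U" using r by (metis imageE)
  qed
qed

text \<open>A selection is the uniform limit of functions with values in a dense sequence, the \<open>n\<close>-th one being
  closer than \<open>2\<^sup>-\<^sup>n\<close> to \<open>F\<close>. Each is chosen within \<open>2\<^sup>-\<^sup>n\<close> of a point of \<open>F\<close> that is also close to its
  predecessor, by taking the least admissible index: this keeps the choice measurable, because admissibility only asks
  whether \<open>F\<close> meets an open set. Completeness gives the limit, and closed values put it in \<open>F\<close>.\<close>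

theorem Kuratowski_Ryll_Nardzewski:
  fixes F :: "'a \<Rightarrow> 'x::{complete_space, second_countable_topology} set"
  assumes F: "set_measurable A F"
  obtains f where "f \<in> borel_measurable A" "\<And>x. x \<in> space A \<Longrightarrow> f x \<in> F x"
proof -
  obtain d :: "nat \<Rightarrow> 'x" where d: "\<And>U. open U \<Longrightarrow> U \<noteq> {} \<Longrightarrow> \<exists>k. d k \<in> U"
    using dense_sequence_exists by blast
  have hit: "open U \<Longrightarrow> Measurable.pred A (\<lambda>x. F x \<inter> U \<noteq> {})" for U
    using F unfolding set_measurable_def pred_def by blast
  have cover: "\<exists>k. y \<in> ball (d k) e" if e: "0 < e" for y e
  proof -
    obtain k where "d k \<in> ball y e" using d[of "ball y e"] e by auto
    then show ?thesis by (auto simp: dist_commute)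
  qed
  define \<epsilon> :: "nat \<Rightarrow> real" where "\<epsilon> n = (1/2)^n" for n
  have \<epsilon>: "0 < \<epsilon> n" for n by (simp add: \<epsilon>_def)
  \<comment> \<open>the next index after \<open>j\<close>: its ball must meet \<open>F\<close> inside the previous ball\<close>
  define step where
    "step n j x = (LEAST k. F x \<inter> (ball (d j) (\<epsilon> n) \<inter> ball (d k) (\<epsilon> (Suc n))) \<noteq> {})" for n j x
  define K where "K = rec_nat (\<lambda>x. LEAST k. F x \<inter> ball (d k) (\<epsilon> 0) \<noteq> {})
      (\<lambda>n k x. step n (k x) x)"
  have K0: "K 0 x = (LEAST k. F x \<inter> ball (d k) (\<epsilon> 0) \<noteq> {})"
    and KS: "K (Suc n) x = step n (K n x) x" for n x by (simp_all add: K_def)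
  have meas: "K n \<in> measurable A (count_space UNIV)" for n
  proof (induction n)
    case 0
    show ?case unfolding K0[abs_def] by (intro measurable_Least hit open_ball)
  next
    case (Suc n)
    have "(\<lambda>x. step n j x) \<in> measurable A (count_space UNIV)" for j
      unfolding step_def by (intro measurable_Least hit open_Int open_ball)
    then show ?case unfolding KS[abs_def]
      using Suc by (rule measurable_compose_countable)
  qed
  have inv: "F x \<inter> ball (d (K n x)) (\<epsilon> n) \<noteq> {}
      \<and> dist (d (K n x)) (d (K (Suc n) x)) < 2 * \<epsilon> n" if x: "x \<in> space A" for n x
  proof -
    have stepI: "F x \<inter> (ball (d j) (\<epsilon> n) \<inter> ball (d (step n j x)) (\<epsilon> (Suc n))) \<noteq> {}"
      if j: "F x \<inter> ball (d j) (\<epsilon> n) \<noteq> {}" for n j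
    proof -
      obtain y where y: "y \<in> F x" "y \<in> ball (d j) (\<epsilon> n)" using j by blast
      obtain k where "y \<in> ball (d k) (\<epsilon> (Suc n))" using cover[OF \<epsilon>] by blast
      then have "F x \<inter> (ball (d j) (\<epsilon> n) \<inter> ball (d k) (\<epsilon> (Suc n))) \<noteq> {}" using y by blast
      then show ?thesis unfolding step_def by (rule LeastI)
    qed
    have main: "F x \<inter> ball (d (K n x)) (\<epsilon> n) \<noteq> {}" for n
    proof (induction n)
      case 0
      obtain y where y: "y \<in> F x" using F x unfolding set_measurable_def by blast
      obtain k where "y \<in> ball (d k) (\<epsilon> 0)" using cover[OF \<epsilon>] by blast
      then have "F x \<inter> ball (d k) (\<epsilon> 0) \<noteq> {}" using y by blast
      then show ?case unfolding K0 by (rule LeastI)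
    next
      case (Suc n)
      then show ?case using stepI[of "K n x" n] unfolding KS by blast
    qed
    obtain y where "dist (d (K n x)) y < \<epsilon> n" "dist (d (K (Suc n) x)) y < \<epsilon> (Suc n)"
      using stepI[OF main[of n]] unfolding KS by auto
    then have "dist (d (K n x)) (d (K (Suc n) x)) < \<epsilon> n + \<epsilon> (Suc n)"
      using dist_triangle2[of "d (K n x)" "d (K (Suc n) x)" y] by linarith
    also have "\<dots> \<le> 2 * \<epsilon> n" by (simp add: \<epsilon>_def)
    finally show ?thesis using main by blast
  qed
  have conv: "convergent (\<lambda>n. d (K n x))" if x: "x \<in> space A" for x
  proof -
    have tail: "dist (d (K n x)) (d (K (n + k) x)) \<le> 4 * \<epsilon> n - 4 * \<epsilon> (n + k)" for n k
    proof (induction k)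
      case (Suc k)
      have "dist (d (K n x)) (d (K (n + Suc k) x)) \<le> 4 * \<epsilon> n - 4 * \<epsilon> (n + k) + 2 * \<epsilon> (n + k)"
        using Suc inv[OF x, of "n + k"] dist_triangle[of "d (K n x)" "d (K (n + Suc k) x)" "d (K (n + k) x)"]
        by simp
      then show ?case by (simp add: \<epsilon>_def)
    qed simp
    have "Cauchy (\<lambda>n. d (K n x))"
    proof (rule metric_CauchyI)
      fix e :: real assume "0 < e"
      then obtain N where N: "\<epsilon> N < e / 8"
        using real_arch_pow_inv[of "e / 8" "1/2"] unfolding \<epsilon>_def by auto
      have near: "dist (d (K N x)) (d (K m x)) < e / 2" if m: "m \<ge> N" for m
        using tail[of N "m - N"] m N \<epsilon>[of m] by simp
      have "dist (d (K m x)) (d (K n x)) < e" if "m \<ge> N" "n \<ge> N" for m n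
        using near[OF that(1)] near[OF that(2)] dist_triangle3[of "d (K m x)" "d (K n x)" "d (K N x)"]
        by linarith
      then show "\<exists>N. \<forall>m\<ge>N. \<forall>n\<ge>N. dist (d (K m x)) (d (K n x)) < e" by blast
    qed
    then show ?thesis by (rule Cauchy_convergent)
  qed
  define f where "f x = lim (\<lambda>n. d (K n x))" for x
  have lim: "(\<lambda>n. d (K n x)) \<longlonglongrightarrow> f x" if "x \<in> space A" for x
    using conv[OF that] unfolding f_def convergent_LIMSEQ_iff .
  show ?thesis
  proof (rule that)
    show "f \<in> borel_measurable A"
    proof (rule borel_measurable_LIMSEQ_metric)
      show "(\<lambda>x. d (K n x)) \<in> borel_measurable A" for n
        using meas by (rule measurable_compose) simp
    qed (rule lim)
  next
    fix x assume x: "x \<in> space A"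
    have "\<exists>y. y \<in> F x \<and> dist (d (K n x)) y < \<epsilon> n" for n using inv[OF x, of n] by auto
    then obtain y where y: "\<And>n. y n \<in> F x" "\<And>n. dist (d (K n x)) (y n) < \<epsilon> n" by metis
    have "\<epsilon> \<longlonglongrightarrow> 0" unfolding \<epsilon>_def[abs_def] by (intro LIMSEQ_power_zero) simp
    then have z: "(\<lambda>n. \<epsilon> n + dist (d (K n x)) (f x)) \<longlonglongrightarrow> 0 + 0"
      by (rule tendsto_add[OF _ iffD1[OF tendsto_dist_iff lim[OF x]]])
    have "dist (y n) (f x) \<le> \<epsilon> n + dist (d (K n x)) (f x)" for n
      using y(2)[of n] dist_triangle3[of "y n" "f x" "d (K n x)"] by linarith
    then have "(\<lambda>n. dist (y n) (f x)) \<longlonglongrightarrow> 0"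
      using z by (intro tendsto_sandwich[OF _ _ tendsto_const[of 0] z[simplified]]) auto
    then have "y \<longlonglongrightarrow> f x" by (rule iffD2[OF tendsto_dist_iff])
    moreover have "closed (F x)" using F x unfolding set_measurable_def by blast
    ultimately show "f x \<in> F x" using y(1) by (meson closed_sequentially)
  qed
qed

text \<open>Whenever \<open>J\<close> meets a ball, there is a selection of \<open>J\<close> lying in that ball on the event
  that this happens, and its bound by \<open>R\<close> passes to the centre up to the radius. Balls of radius
  \<open>1/n\<close> around a dense sequence reach every point of \<open>J\<close>, and being countably many
  they leave a single null set. The given selection \<open>j0\<close> serves off the event: it
  makes the selections integrable, hence admissible for the bound.\<close>

lemma normK_bound_of_selections:
  fixes J :: "'w \<Rightarrow> 'x::{banach,second_countable_topology} set"
  assumes "prob_space M" and sub: "subalgebra M G" and J: "set_measurable G J"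
    and j0: "j0 \<in> selections1 M G J"
    and bound: "\<And>j. j \<in> selections1 M G J \<Longrightarrow> AE \<omega> in M. ennreal (norm (j \<omega>)) \<le> R \<omega>"
  shows "AE \<omega> in M. normK (J \<omega>) \<le> R \<omega>"
proof -
  interpret prob_space M by fact
  have sp: "space G = space M" and le: "sets G \<subseteq> sets M" using sub by (auto simp: subalgebra_def)
  have GM: "f \<in> borel_measurable G \<Longrightarrow> f \<in> borel_measurable M" for f :: "'w \<Rightarrow> 'x"
    using sub by (rule measurable_from_subalg)
  obtain d :: "nat \<Rightarrow> 'x" where d: "\<And>U. open U \<Longrightarrow> U \<noteq> {} \<Longrightarrow> \<exists>k. d k \<in> U"
    using dense_sequence_exists by blast
  have local: "AE \<omega> in M. J \<omega> \<inter> ball c r \<noteq> {} \<longrightarrow> ennreal (norm c) \<le> R \<omega> + ennreal r"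
    if r: "0 < r" for c r
  proof -
    define E where "E = {\<omega>\<in>space G. J \<omega> \<inter> ball c r \<noteq> {}}"
    \<comment> \<open>the closure supplies closed values and meets the same open sets as \<open>J \<inter> ball c r\<close>\<close>
    define H where "H \<omega> = (if \<omega> \<in> E then closure (J \<omega> \<inter> ball c r) else {0})" for \<omega>
    have hit: "{\<omega>\<in>space G. J \<omega> \<inter> U \<noteq> {}} \<in> sets G" if "open U" for U
      using J that unfolding set_measurable_def by blast
    have E: "E \<in> sets G" unfolding E_def by (rule hit) simp
    have "set_measurable G H"
      unfolding set_measurable_def
    proof (intro conjI ballI allI impI)
      fix U :: "'x set" assume U: "open U"
      have "{\<omega>\<in>space G. H \<omega> \<inter> U \<noteq> {}} =
          (E \<inter> {\<omega>\<in>space G. J \<omega> \<inter> (ball c r \<inter> U) \<noteq> {}}) \<union> (if 0 \<in> U then space G - E else {})"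
        using open_Int_closure_eq_empty[OF U] by (auto simp: H_def Int_ac)
      also have "\<dots> \<in> sets G"
        using E hit[of "ball c r \<inter> U"] U by auto
      finally show "{\<omega>\<in>space G. H \<omega> \<inter> U \<noteq> {}} \<in> sets G" .
    qed (auto simp: H_def E_def closure_eq_empty)
    then obtain g where g: "g \<in> borel_measurable G" "\<And>\<omega>. \<omega> \<in> space G \<Longrightarrow> g \<omega> \<in> H \<omega>"
      by (rule Kuratowski_Ryll_Nardzewski) blast
    have gE: "g \<omega> \<in> J \<omega>" "dist c (g \<omega>) \<le> r" if "\<omega> \<in> E" for \<omega>
    proof -
      have \<omega>: "\<omega> \<in> space G" "g \<omega> \<in> closure (J \<omega> \<inter> ball c r)"
        using that g(2)[of \<omega>] by (auto simp: E_def H_def)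
      have "closed (J \<omega>)" using J \<omega> unfolding set_measurable_def by blast
      then show "g \<omega> \<in> J \<omega>" using \<omega>(2) closure_minimal[of "J \<omega> \<inter> ball c r" "J \<omega>"] by blast
      show "dist c (g \<omega>) \<le> r"
        using \<omega>(2) closure_minimal[OF le_infI2[OF ball_subset_cball] closed_cball, of "J \<omega>" c r] by auto
    qed
    define j where "j \<omega> = (if \<omega> \<in> E then g \<omega> else j0 \<omega>)" for \<omega>
    have j0': "j0 \<in> borel_measurable G" "integrable M j0" "AE \<omega> in M. j0 \<omega> \<in> J \<omega>"
      using j0 by (auto simp: selections1_def)
    have jm: "j \<in> borel_measurable G"
      unfolding j_def by (rule measurable_If_set) (use g j0' E in auto)
    have "integrable M j"
    proof (rule Bochner_Integration.integrable_bound)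
      show "integrable M (\<lambda>\<omega>. norm (j0 \<omega>) + (norm c + r))" using j0' by simp
      show "AE \<omega> in M. norm (j \<omega>) \<le> norm (norm (j0 \<omega>) + (norm c + r))"
      proof (rule AE_I2)
        fix \<omega>
        have "norm (g \<omega>) \<le> norm c + r" if "\<omega> \<in> E"
          using gE(2)[OF that] norm_triangle_ineq2[of "g \<omega>" c] by (simp add: dist_norm norm_minus_commute)
        then show "norm (j \<omega>) \<le> norm (norm (j0 \<omega>) + (norm c + r))"
          using r by (auto simp: j_def add_increasing)
      qed
    qed (rule GM[OF jm])
    moreover have "AE \<omega> in M. j \<omega> \<in> J \<omega>"
      using j0'(3) by eventually_elim (auto simp: j_def gE)
    ultimately have "j \<in> selections1 M G J" using jm by (simp add: selections1_def)
    from bound[OF this] AE_space show ?thesis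
    proof eventually_elim
      case (elim \<omega>)
      show ?case
      proof
        assume "J \<omega> \<inter> ball c r \<noteq> {}"
        then have \<omega>: "\<omega> \<in> E" using elim by (simp add: E_def sp)
        have "norm c \<le> norm (j \<omega>) + r"
          using gE(2)[OF \<omega>] norm_triangle_ineq2[of c "g \<omega>"] \<omega> by (simp add: dist_norm j_def)
        then have "ennreal (norm c) \<le> ennreal (norm (j \<omega>)) + ennreal r"
          using r by (simp add: ennreal_leI flip: ennreal_plus)
        also have "\<dots> \<le> R \<omega> + ennreal r" using elim by (intro add_right_mono)
        finally show "ennreal (norm c) \<le> R \<omega> + ennreal r" .
      qed
    qed
  qed
  have "AE \<omega> in M. \<forall>k n. J \<omega> \<inter> ball (d k) (1 / Suc n) \<noteq> {} \<longrightarrow>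
      ennreal (norm (d k)) \<le> R \<omega> + ennreal (1 / Suc n)"
    unfolding AE_all_countable by (intro allI local) simp
  then show ?thesis
  proof eventually_elim
    case (elim \<omega>)
    show "normK (J \<omega>) \<le> R \<omega>"
      unfolding normK_le_iff
    proof (rule ballI, rule ennreal_le_epsilon)
      fix x and e :: real assume x: "x \<in> J \<omega>" and e: "0 < e"
      obtain n where n: "1 / real (Suc n) < e / 2" using e nat_approx_posE[of "e / 2"] by auto
      obtain k where k: "d k \<in> ball x (1 / Suc n)" using d[of "ball x (1 / Suc n)"] by auto
      then have "x \<in> J \<omega> \<inter> ball (d k) (1 / Suc n)" using x by (simp add: dist_commute)
      then have *: "ennreal (norm (d k)) \<le> R \<omega> + ennreal (1 / Suc n)" using elim by blast
      have "norm x \<le> norm (d k) + 1 / Suc n"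
        using k norm_triangle_ineq2[of x "d k"] by (simp add: dist_norm)
      then have "ennreal (norm x) \<le> ennreal (norm (d k)) + ennreal (1 / Suc n)"
        by (simp add: ennreal_leI flip: ennreal_plus)
      also have "\<dots> \<le> R \<omega> + ennreal (1 / Suc n) + ennreal (1 / Suc n)"
        using * by (intro add_right_mono)
      also have "\<dots> = R \<omega> + ennreal (1 / Suc n + 1 / Suc n)"
        by (simp add: add.assoc flip: ennreal_plus)
      also have "\<dots> \<le> R \<omega> + ennreal e" using n by (intro add_left_mono ennreal_leI) simp
      finally show "ennreal (norm x) \<le> R \<omega> + ennreal e" .
    qed
  qed
qed

section \<open>Decomposable hulls and dominated sets of variables\<close>

lemma decomposable_hull_bound:
  fixes \<Gamma> :: "('w \<Rightarrow> 'x::{banach,second_countable_topology}) set"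
  assumes sp: "space G = space M"
    and \<Gamma>: "\<And>g. g \<in> \<Gamma> \<Longrightarrow> AE \<omega> in M. ennreal (norm (g \<omega>)) \<le> R \<omega>"
    and h: "h \<in> decomposable_hull G \<Gamma>"
  shows "AE \<omega> in M. ennreal (norm (h \<omega>)) \<le> R \<omega>"
proof -
  obtain m :: nat and A g where h_eq: "h = (\<lambda>\<omega>. \<Sum>i=1..m. indicator (A i) \<omega> *\<^sub>R g i \<omega>)"
    and g: "\<forall>i\<in>{1..m}. A i \<in> sets G \<and> g i \<in> \<Gamma>"
    and A: "disjoint_family_on A {1..m}" "(\<Union>i\<in>{1..m}. A i) = space G"
    using h unfolding decomposable_hull_def by auto
  have "AE \<omega> in M. \<forall>i\<in>{1..m}. ennreal (norm (g i \<omega>)) \<le> R \<omega>"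
    using g \<Gamma> by (intro AE_finite_allI) auto
  with AE_space show ?thesis
  proof eventually_elim
    case (elim \<omega>)
    have "\<omega> \<in> (\<Union>i\<in>{1..m}. A i)" using elim A(2) sp by simp
    then obtain i where i: "i \<in> {1..m}" "\<omega> \<in> A i" by blast
    have "\<omega> \<notin> A k" if "k \<in> {1..m}" "k \<noteq> i" for k
      using A(1) i that unfolding disjoint_family_on_def by blast
    then have "h \<omega> = (\<Sum>k\<in>{1..m}. if k = i then g i \<omega> else 0)"
      unfolding h_eq using i by (intro sum.cong) auto
    then show ?case using i elim by simp
  qed
qed

text \<open>The excess of \<open>\<parallel>h\<parallel>\<close> over \<open>R\<close> is at most \<open>\<parallel>g - h\<parallel>\<close> for every \<open>g\<close> bounded by \<open>R\<close>, so its
  integral is arbitrarily small.\<close>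

lemma L1_closure_bound:
  fixes \<Gamma> :: "('w \<Rightarrow> 'x::{banach,second_countable_topology}) set"
  assumes R[measurable]: "R \<in> borel_measurable M"
    and \<Gamma>: "\<And>g. g \<in> \<Gamma> \<Longrightarrow> AE \<omega> in M. ennreal (norm (g \<omega>)) \<le> R \<omega>"
    and h: "h \<in> L1_closure M \<Gamma>"
  shows "AE \<omega> in M. ennreal (norm (h \<omega>)) \<le> R \<omega>"
proof -
  have hi: "integrable M h" using h by (simp add: L1_closure_def)
  then have [measurable]: "h \<in> borel_measurable M" by auto
  have "(\<integral>\<^sup>+\<omega>. ennreal (norm (h \<omega>)) - R \<omega> \<partial>M) \<le> 0"
  proof (rule ennreal_le_epsilon)
    fix e :: real assume "0 < e"
    then obtain g where g: "g \<in> \<Gamma>" "integrable M g" "(LINT \<omega>|M. norm (g \<omega> - h \<omega>)) < e"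
      using h unfolding L1_closure_def by blast
    have "(\<integral>\<^sup>+\<omega>. ennreal (norm (h \<omega>)) - R \<omega> \<partial>M) \<le> (\<integral>\<^sup>+\<omega>. ennreal (norm (g \<omega> - h \<omega>)) \<partial>M)"
    proof (rule nn_integral_mono_AE)
      show "AE \<omega> in M. ennreal (norm (h \<omega>)) - R \<omega> \<le> ennreal (norm (g \<omega> - h \<omega>))"
        using \<Gamma>[OF g(1)]
      proof eventually_elim
        case (elim \<omega>)
        have "ennreal (norm (h \<omega>)) \<le> ennreal (norm (g \<omega>)) + ennreal (norm (g \<omega> - h \<omega>))"
          using norm_triangle_sub[of "h \<omega>" "g \<omega>"]
          by (simp add: ennreal_leI norm_minus_commute flip: ennreal_plus)
        also have "\<dots> \<le> R \<omega> + ennreal (norm (g \<omega> - h \<omega>))" using elim by (rule add_right_mono)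
        finally show ?case by (simp add: ennreal_minus_le_iff)
      qed
    qed
    also have "\<dots> = ennreal (LINT \<omega>|M. norm (g \<omega> - h \<omega>))"
      using g(2) hi by (intro nn_integral_eq_integral) auto
    also have "\<dots> \<le> 0 + ennreal e" using g(3) by (simp add: ennreal_leI)
    finally show "(\<integral>\<^sup>+\<omega>. ennreal (norm (h \<omega>)) - R \<omega> \<partial>M) \<le> 0 + ennreal e" .
  qed
  then have "AE \<omega> in M. ennreal (norm (h \<omega>)) - R \<omega> = 0"
    by (subst (asm) le_zero_eq, subst (asm) nn_integral_0_iff_AE) auto
  then show ?thesis
    by eventually_elim (metis diff_eq_0_iff_ennreal diff_gt_0_iff_gt_ennreal not_gr_zero not_le)
qed

section \<open>Predictable sets of a marked point process\<close>

text \<open>A marked point process on \<open>(0,T]\<close> with finitely many points on every path: \<open>D \<omega>\<close> is the set of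
  jump times and \<open>q \<omega> s\<close> the mark at time \<open>s\<close>. Having one mark for each time means that no two points
  occur simultaneously. The last hypothesis is the martingale property of the
  compensated counts in integrated form.\<close>

locale marked_jumps = prob_space M for M :: "'w measure" +
  fixes \<F> :: "real \<Rightarrow> 'w measure"
    and \<nu> :: "'z::second_countable_topology measure"
    and T :: real
    and D :: "'w \<Rightarrow> real set"
    and q :: "'w \<Rightarrow> real \<Rightarrow> 'z"
  assumes filtration: "filtration_on M {0..} \<F>"
    and finite_intensity: "finite_measure \<nu>" and sets_intensity [measurable_cong]: "sets \<nu> = sets borel"
    and T_pos: "0 < T"
    and finite_jumps: "finite (D \<omega>)" and jumps_subset: "D \<omega> \<subseteq> {0<..T}"
    and adapted_count: "0 \<le> t \<Longrightarrow> t \<le> T \<Longrightarrow> U \<in> sets borel \<Longrightarrow>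
      (\<lambda>\<omega>. real (card {s\<in>D \<omega>. s \<le> t \<and> q \<omega> s \<in> U})) \<in> borel_measurable (\<F> t)"
    and count_compensator: "0 \<le> a \<Longrightarrow> a \<le> b \<Longrightarrow> b \<le> T \<Longrightarrow> U \<in> sets borel \<Longrightarrow> B \<in> sets (\<F> a) \<Longrightarrow>
      (\<integral>\<^sup>+\<omega>. ennreal (real (card {s\<in>D \<omega>. a < s \<and> s \<le> b \<and> q \<omega> s \<in> U})) * indicator B \<omega> \<partial>M) =
      ennreal (b - a) * emeasure \<nu> U * emeasure M B"
begin

lemma subalgebra_filtration: "0 \<le> t \<Longrightarrow> subalgebra M (\<F> t)"
  and filtration_mono: "0 \<le> s \<Longrightarrow> s \<le> t \<Longrightarrow> sets (\<F> s) \<subseteq> sets (\<F> t)"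
  using filtration by (auto simp: filtration_on_def)

lemma space_filtration: "0 \<le> t \<Longrightarrow> space (\<F> t) = space M"
  and sets_filtration: "0 \<le> t \<Longrightarrow> sets (\<F> t) \<subseteq> sets M"
  using subalgebra_filtration by (auto simp: subalgebra_def)

lemma space_intensity: "space \<nu> = UNIV"
  using sets_eq_imp_space_eq[OF sets_intensity] by simp

lemma adapted_count_Ioc:
  assumes "0 \<le> a" "a \<le> t" "t \<le> T" "U \<in> sets borel"
  shows "(\<lambda>\<omega>. real (card {s\<in>D \<omega>. a < s \<and> s \<le> t \<and> q \<omega> s \<in> U})) \<in> borel_measurable (\<F> t)"
proof -
  have eq: "real (card {s\<in>D \<omega>. a < s \<and> s \<le> t \<and> q \<omega> s \<in> U}) =
      real (card {s\<in>D \<omega>. s \<le> t \<and> q \<omega> s \<in> U}) - real (card {s\<in>D \<omega>. s \<le> a \<and> q \<omega> s \<in> U})" for \<omega>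
  proof -
    have "card {s\<in>D \<omega>. s \<le> t \<and> q \<omega> s \<in> U} =
        card ({s\<in>D \<omega>. a < s \<and> s \<le> t \<and> q \<omega> s \<in> U} \<union> {s\<in>D \<omega>. s \<le> a \<and> q \<omega> s \<in> U})"
      using assms by (intro arg_cong[where f=card]) auto
    also have "\<dots> = card {s\<in>D \<omega>. a < s \<and> s \<le> t \<and> q \<omega> s \<in> U} + card {s\<in>D \<omega>. s \<le> a \<and> q \<omega> s \<in> U}"
      using finite_jumps by (intro card_Un_disjoint) auto
    finally show ?thesis by simp
  qed
  have "(\<lambda>\<omega>. real (card {s\<in>D \<omega>. s \<le> a \<and> q \<omega> s \<in> U})) \<in> borel_measurable (\<F> t)"
  proof (rule measurable_from_subalg)
    show "subalgebra (\<F> t) (\<F> a)"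
      using assms space_filtration filtration_mono by (auto simp: subalgebra_def)
  qed (use assms in \<open>auto intro!: adapted_count\<close>)
  with adapted_count[of t U] assms show ?thesis unfolding eq by simp
qed

text \<open>The sets \<open>{a<..b} \<times> U \<times> B\<close> alone would not generate anything on the slice \<open>t = 0\<close>, whereas left-continuous
  functions are unrestricted there apart from being measurable at time \<open>0\<close>.\<close>

definition rects :: "(real \<times> 'z \<times> 'w) set set" where
  "rects = {I \<times> U \<times> B | I U B a. 0 \<le> a \<and> U \<in> sets borel \<and> B \<in> sets (\<F> a) \<and>
     (I = {0} \<and> a = 0 \<or> (\<exists>b\<le>T. I = {a<..b}))}"

definition index_space :: "(real \<times> 'z \<times> 'w) set" where
  "index_space = {0..T} \<times> UNIV \<times> space M"

definition predictable :: "(real \<times> 'z \<times> 'w) measure" where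
  "predictable = sigma index_space rects"

definition intensity :: "(real \<times> 'z \<times> 'w) measure" where
  "intensity = restrict_space lborel {0..T} \<Otimes>\<^sub>M (\<nu> \<Otimes>\<^sub>M M)"

lemma rects_initial: "U \<in> sets borel \<Longrightarrow> B \<in> sets (\<F> 0) \<Longrightarrow> {0} \<times> U \<times> B \<in> rects"
  unfolding rects_def by blast

lemma rects_Ioc:
  "0 \<le> a \<Longrightarrow> b \<le> T \<Longrightarrow> U \<in> sets borel \<Longrightarrow> B \<in> sets (\<F> a) \<Longrightarrow> {a<..b} \<times> U \<times> B \<in> rects"
  unfolding rects_def by blast

lemma rects_cases:
  assumes "A \<in> rects"
  obtains (initial) U B where "A = {0} \<times> U \<times> B" "U \<in> sets borel" "B \<in> sets (\<F> 0)"
  | (Ioc) a b U B where "A = {a<..b} \<times> U \<times> B" "0 \<le> a" "b \<le> T" "U \<in> sets borel" "B \<in> sets (\<F> a)"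
  using assms unfolding rects_def by blast

lemma empty_rects: "{} \<in> rects"
  using rects_initial[of "{}" "{}"] by simp

lemma rects_subset: "rects \<subseteq> Pow index_space"
proof
  fix A assume "A \<in> rects"
  then show "A \<in> Pow index_space"
    using T_pos by (cases rule: rects_cases)
      (auto simp: index_space_def space_filtration dest!: sets.sets_into_space)
qed

text \<open>The intersection of two half-open rectangles starts at the later of the two left ends,
  at which both events are known.\<close>

lemma rects_Int_stable: "Int_stable rects"
proof (rule Int_stableI)
  fix A A' assume "A \<in> rects" "A' \<in> rects"
  then show "A \<inter> A' \<in> rects"
  proof (cases rule: rects_cases[case_product rects_cases])
    case (initial_initial U B U' B')
    have "A \<inter> A' = {0} \<times> (U \<inter> U') \<times> (B \<inter> B')" using initial_initial by auto
    with initial_initial show ?thesis by (auto intro!: rects_initial)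
  next
    case (Ioc_Ioc a b U B a' b' U' B')
    have "A \<inter> A' = {max a a'<..min b b'} \<times> (U \<inter> U') \<times> (B \<inter> B')" using Ioc_Ioc by auto
    moreover have "B \<in> sets (\<F> (max a a'))" "B' \<in> sets (\<F> (max a a'))"
      using Ioc_Ioc filtration_mono[of a "max a a'"] filtration_mono[of a' "max a a'"] by auto
    ultimately show ?thesis using Ioc_Ioc by (auto intro!: rects_Ioc)
  next
    case (initial_Ioc U B a b U' B')
    have "A \<inter> A' = {}" using initial_Ioc by auto
    then show ?thesis by (simp add: empty_rects)
  next
    case (Ioc_initial a b U B U' B')
    have "A \<inter> A' = {}" using Ioc_initial by auto
    then show ?thesis by (simp add: empty_rects)
  qed
qed

lemma space_predictable: "space predictable = index_space"
  and sets_predictable: "sets predictable = sigma_sets index_space rects"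
  using rects_subset by (simp_all add: predictable_def)

lemma rects_predictable: "A \<in> rects \<Longrightarrow> A \<in> sets predictable"
  by (simp add: sets_predictable sigma_sets.Basic)

lemma space_intensity_measure: "space intensity = index_space"
  by (simp add: intensity_def index_space_def space_pair_measure space_restrict_space space_intensity)

lemma predictable_subset: "sets predictable \<subseteq> sets intensity"
proof -
  have "A \<in> sets intensity" if "A \<in> rects" for A
    using that
  proof (cases rule: rects_cases)
    case (initial U B)
    have "{0} \<in> sets (restrict_space lborel {0..T})" using T_pos by (subst sets_restrict_space_iff) auto
    then show ?thesis using initial sets_filtration[of 0] unfolding intensity_def
      by (auto intro!: pair_measureI simp: sets_intensity)
  next
    case (Ioc a b U B)
    have "{a<..b} \<in> sets (restrict_space lborel {0..T})" using Ioc by (subst sets_restrict_space_iff) auto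
    then show ?thesis using Ioc sets_filtration[of a] unfolding intensity_def
      by (auto intro!: pair_measureI simp: sets_intensity)
  qed
  then show ?thesis
    unfolding sets_predictable using space_intensity_measure by (metis sets.sigma_sets_subset subsetI)
qed

lemma measurable_intensity: "f \<in> measurable predictable N \<Longrightarrow> f \<in> measurable intensity N"
  using predictable_subset space_intensity_measure space_predictable
  by (intro measurable_from_subalg[of intensity predictable]) (auto simp: subalgebra_def)

text \<open>The largest point of the grid of mesh \<open>1/(n+1)\<close> strictly before \<open>t\<close>. Strictness gives left limits and makes
  the value known just before time \<open>t\<close>; at \<open>t = 0\<close> no earlier point exists, and the value is \<open>0\<close>.\<close>

definition lag :: "nat \<Rightarrow> real \<Rightarrow> real" where
  "lag n t = max 0 ((of_int \<lceil>t * real (Suc n)\<rceil> - 1) / real (Suc n))"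

lemma lag_Ioc: "lag n t = real k / Suc n" if "real k / Suc n < t" "t \<le> (real k + 1) / Suc n"
proof -
  have "\<lceil>t * real (Suc n)\<rceil> = int k + 1"
    using that by (intro ceiling_unique) (simp_all add: field_simps)
  then show ?thesis by (simp add: lag_def)
qed

lemma lag_0: "lag n 0 = 0"
  by (simp add: lag_def)

lemma lag_less: "0 < t \<Longrightarrow> lag n t < t"
  unfolding lag_def by (simp add: field_simps) linarith

lemma lag_ge: "t - 1 / real (Suc n) \<le> lag n t"
proof -
  have "(t * Suc n - 1) / Suc n \<le> (of_int \<lceil>t * real (Suc n)\<rceil> - 1) / Suc n"
    by (intro divide_right_mono) auto
  also have "(t * Suc n - 1) / Suc n = t - 1 / Suc n" by (simp add: field_simps)
  finally show ?thesis unfolding lag_def by simp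
qed

lemma lag_at_left: assumes "0 < t" shows "filterlim (\<lambda>n. lag n t) (at_left t) sequentially"
proof -
  have lower: "(\<lambda>n. t - 1 / real (Suc n)) \<longlonglongrightarrow> t"
    using tendsto_diff[OF tendsto_const LIMSEQ_Suc[OF lim_1_over_n], of t] by simp
  have "(\<lambda>n. lag n t) \<longlonglongrightarrow> t"
  proof (rule real_tendsto_sandwich[OF _ _ lower tendsto_const])
    show "\<forall>\<^sub>F n in sequentially. t - 1 / real (Suc n) \<le> lag n t" by (simp only: lag_ge eventually_True)
    show "\<forall>\<^sub>F n in sequentially. lag n t \<le> t"
      by (simp only: less_imp_le[OF lag_less[OF assms]] eventually_True)
  qed
  then show ?thesis using lag_less[OF assms] by (simp add: filterlim_at less_imp_neq)
qed

text \<open>Between two grid points the lagged function does not depend on time and only uses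
  the information at the left grid point, so its preimages of measurable sets are countable unions of sets \<open>{a<..b} \<times> C\<close> with
  \<open>C\<close> measurable at time \<open>a\<close>.\<close>

lemma measurable_lagged:
  assumes g: "\<And>t. t \<in> {0..T} \<Longrightarrow> (\<lambda>(z, \<omega>). g (t, z, \<omega>)) \<in> measurable (borel \<Otimes>\<^sub>M \<F> t) N"
  shows "(\<lambda>(t, z, \<omega>). g (lag n t, z, \<omega>)) \<in> measurable predictable N"
proof -
  have piece: "(\<lambda>(t, z, \<omega>). g (lag n t, z, \<omega>)) \<in> measurable (restrict_space predictable (I \<times> UNIV \<times> space M)) N"
    if a: "0 \<le> a" "a \<le> T" and I: "\<And>t. t \<in> I \<Longrightarrow> lag n t = a"
      and rect: "\<And>U B. U \<in> sets borel \<Longrightarrow> B \<in> sets (\<F> a) \<Longrightarrow> I \<times> U \<times> B \<in> rects" for I a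
  proof -
    let ?P = "I \<times> (UNIV :: 'z set) \<times> space M"
    let ?R = "restrict_space predictable ?P"
    have P: "?P \<in> sets predictable"
      using rect[of UNIV "space M"] a space_filtration[OF a(1)] sets.top[of "\<F> a"]
      by (simp add: rects_predictable)
    have sub: "?P \<subseteq> index_space" using P sets.sets_into_space space_predictable by blast
    have sp: "space ?R = ?P" using sub by (auto simp: space_restrict_space space_predictable)
    have in_R: "X \<in> sets ?R" if "X \<in> rects" "X \<subseteq> ?P" for X
      using that P by (subst sets_restrict_space_iff) (auto simp: rects_predictable)
    have "(\<lambda>x. fst (snd x)) \<in> measurable ?R borel"
    proof (rule measurableI)
      fix U :: "'z set" assume "U \<in> sets borel"
      moreover have "(\<lambda>x. fst (snd x)) -` U \<inter> space ?R = I \<times> U \<times> space M" unfolding sp by auto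
      ultimately show "(\<lambda>x. fst (snd x)) -` U \<inter> space ?R \<in> sets ?R"
        using a space_filtration[OF a(1)] sets.top[of "\<F> a"] by (auto intro!: in_R rect)
    qed simp
    moreover have "(\<lambda>x. snd (snd x)) \<in> measurable ?R (\<F> a)"
    proof (rule measurableI)
      fix B assume B: "B \<in> sets (\<F> a)"
      then have "B \<subseteq> space M" using sets.sets_into_space space_filtration[OF a(1)] by blast
      then have "(\<lambda>x. snd (snd x)) -` B \<inter> space ?R = I \<times> UNIV \<times> B" unfolding sp by auto
      then show "(\<lambda>x. snd (snd x)) -` B \<inter> space ?R \<in> sets ?R"
        using B \<open>B \<subseteq> space M\<close> by (auto intro!: in_R rect)
    next
      fix x assume "x \<in> space ?R"
      then show "snd (snd x) \<in> space (\<F> a)" unfolding sp space_filtration[OF a(1)] by auto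
    qed
    ultimately have "(\<lambda>x. (fst (snd x), snd (snd x))) \<in> measurable ?R (borel \<Otimes>\<^sub>M \<F> a)"
      by (rule measurable_Pair)
    from measurable_compose[OF this g[of a]] a
    have m: "(\<lambda>x. g (a, fst (snd x), snd (snd x))) \<in> measurable ?R N" by simp
    have e: "(case x of (t, z, \<omega>) \<Rightarrow> g (lag n t, z, \<omega>)) = g (a, fst (snd x), snd (snd x))"
      if "x \<in> space ?R" for x
      using that unfolding sp by (auto simp: I)
    show ?thesis
      by (subst measurable_cong[where g="\<lambda>x. g (a, fst (snd x), snd (snd x))"]) (fact e, fact m)
  qed
  define C where "C = insert ({0} \<times> UNIV \<times> space M)
     ((\<lambda>k. {real k / Suc n<..min T ((real k + 1) / Suc n)} \<times> (UNIV :: 'z set) \<times> space M) ` {k. real k / Suc n \<le> T})"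
  have C_cases: "\<exists>I a. P = I \<times> (UNIV :: 'z set) \<times> space M \<and> 0 \<le> a \<and> a \<le> T \<and> (\<forall>t\<in>I. lag n t = a) \<and>
      (\<forall>U\<in>sets borel. \<forall>B\<in>sets (\<F> a). I \<times> U \<times> B \<in> rects)" if P: "P \<in> C" for P
  proof -
    from P consider "P = {0} \<times> UNIV \<times> space M"
      | k where "P = {real k / Suc n<..min T ((real k + 1) / Suc n)} \<times> UNIV \<times> space M" "real k / Suc n \<le> T"
      unfolding C_def by blast
    then show ?thesis
    proof cases
      case 1
      then show ?thesis using T_pos lag_0 rects_initial
        by (intro exI[of _ "{0}"] exI[of _ 0]) auto
    next
      case (2 k)
      then show ?thesis using rects_Ioc[of "real k / Suc n" "min T ((real k + 1) / Suc n)"] lag_Ioc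
        by (intro exI[of _ "{real k / Suc n<..min T ((real k + 1) / Suc n)}"] exI[of _ "real k / Suc n"]) auto
    qed
  qed
  show ?thesis
  proof (rule measurable_piecewise_restrict)
    show "countable C" unfolding C_def by simp
  next
    fix P assume "P \<in> C"
    from C_cases[OF this] obtain I a where P: "P = I \<times> (UNIV :: 'z set) \<times> space M" "0 \<le> a" "a \<le> T"
        "\<forall>t\<in>I. lag n t = a" "\<forall>U\<in>sets borel. \<forall>B\<in>sets (\<F> a). I \<times> U \<times> B \<in> rects"
      by blast
    show "(\<lambda>(t, z, \<omega>). g (lag n t, z, \<omega>)) \<in> measurable (restrict_space predictable P) N"
      unfolding P(1)
    proof (rule piece[OF P(2,3)])
      show "lag n t = a" if "t \<in> I" for t using P(4) that by blast
      show "I \<times> U \<times> B \<in> rects" if "U \<in> sets borel" "B \<in> sets (\<F> a)" for U B using P(5) that by blast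
    qed
    have "space M \<in> sets (\<F> a)" using sets.top[of "\<F> a"] space_filtration[OF P(2)] by simp
    then have "P \<in> rects" unfolding P(1) using P(5) by simp
    then show "P \<inter> space predictable \<in> sets predictable" by (intro sets.Int) (auto simp: rects_predictable)
  next
    show "space predictable \<subseteq> \<Union>C"
    proof
      fix x assume "x \<in> space predictable"
      then obtain t z \<omega> where x: "x = (t, z, \<omega>)" "0 \<le> t" "t \<le> T" "\<omega> \<in> space M"
        by (auto simp: space_predictable index_space_def)
      show "x \<in> \<Union>C"
      proof (cases "t = 0")
        case True
        then show ?thesis using x by (auto simp: C_def)
      next
        case False
        define k where "k = nat (\<lceil>t * real (Suc n)\<rceil> - 1)"
        have "0 < t * Suc n" using False x by simp
        then have "1 \<le> \<lceil>t * real (Suc n)\<rceil>" by linarith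
        then have "real k = of_int \<lceil>t * real (Suc n)\<rceil> - 1" by (simp add: k_def)
        then have "real k < t * Suc n" "t * Suc n \<le> real k + 1" by linarith+
        then have *: "real k / Suc n < t" "t \<le> (real k + 1) / Suc n" by (simp_all add: field_simps)
        then show ?thesis using x unfolding C_def by (intro UnionI[OF insertI2[OF imageI[of k]]]) auto
      qed
    qed
  qed
qed

lemma predictable_left_limit:
  fixes f g :: "real \<times> 'z \<times> 'w \<Rightarrow> 'b::metric_space"
  assumes g: "\<And>t. t \<in> {0..T} \<Longrightarrow> (\<lambda>(z, \<omega>). g (t, z, \<omega>)) \<in> borel_measurable (borel \<Otimes>\<^sub>M \<F> t)"
    and lim: "\<And>t z \<omega>. t \<in> {0..T} \<Longrightarrow> \<omega> \<in> space M \<Longrightarrow> (\<lambda>n. g (lag n t, z, \<omega>)) \<longlonglongrightarrow> f (t, z, \<omega>)"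
  shows "f \<in> borel_measurable predictable"
proof (rule borel_measurable_LIMSEQ_metric)
  show "(\<lambda>(t, z, \<omega>). g (lag n t, z, \<omega>)) \<in> borel_measurable predictable" for n
    using g by (rule measurable_lagged)
next
  fix x assume "x \<in> space predictable"
  then obtain t z \<omega> where "x = (t, z, \<omega>)" "t \<in> {0..T}" "\<omega> \<in> space M"
    unfolding space_predictable index_space_def by blast
  then show "(\<lambda>n. case x of (t, z, \<omega>) \<Rightarrow> g (lag n t, z, \<omega>)) \<longlonglongrightarrow> f x"
    using lim by simp
qed

lemma left_continuous_adapted_predictable:
  fixes g :: "real \<times> 'z \<times> 'w \<Rightarrow> 'b::metric_space"
  assumes "left_continuous_adapted M \<F> T g"
  shows "g \<in> borel_measurable predictable"
proof (rule predictable_left_limit[where g=g])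
  fix t assume "t \<in> {0..T}"
  then show "(\<lambda>(z, \<omega>). g (t, z, \<omega>)) \<in> borel_measurable (borel \<Otimes>\<^sub>M \<F> t)"
    using assms unfolding left_continuous_adapted_def by blast
next
  fix t z \<omega> assume t: "t \<in> {0..T}" and \<omega>: "\<omega> \<in> space M"
  show "(\<lambda>n. g (lag n t, z, \<omega>)) \<longlonglongrightarrow> g (t, z, \<omega>)"
  proof (cases "t = 0")
    case False
    then have "((\<lambda>s. g (s, z, \<omega>)) \<longlongrightarrow> g (t, z, \<omega>)) (at_left t)"
      using assms t \<omega> unfolding left_continuous_adapted_def continuous_within by auto
    from filterlim_compose[OF this lag_at_left] False t show ?thesis by auto
  qed (simp add: lag_0)
qed

text \<open>The inclusion can be strict: over a trivial value space all generating functions are constant, and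
  the left-hand side is trivial.\<close>

lemma pred_sigma_subset:
  "sets (pred_sigma TYPE('b::metric_space) M \<F> T :: (real \<times> 'z \<times> 'w) measure) \<subseteq> sets predictable"
proof -
  let ?G = "{g -` B \<inter> index_space | (g :: real \<times> 'z \<times> 'w \<Rightarrow> 'b) B. left_continuous_adapted M \<F> T g \<and> B \<in> sets borel}"
  have "?G \<subseteq> sets predictable"
  proof safe
    fix g :: "real \<times> 'z \<times> 'w \<Rightarrow> 'b" and B :: "'b set"
    assume "left_continuous_adapted M \<F> T g" "B \<in> sets borel"
    then show "g -` B \<inter> index_space \<in> sets predictable"
      using measurable_sets[OF left_continuous_adapted_predictable] by (simp add: space_predictable)
  qed
  then have "sigma_sets index_space ?G \<subseteq> sets predictable"
    using sets.sigma_sets_subset[of ?G predictable] by (simp add: space_predictable)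
  moreover have "sets (pred_sigma TYPE('b) M \<F> T) = sigma_sets index_space ?G"
    unfolding pred_sigma_def index_space_def by (rule sets_measure_of) auto
  ultimately show ?thesis by simp
qed

lemma space_pred_sigma: "space (pred_sigma TYPE('b::topological_space) M \<F> T :: (real \<times> 'z \<times> 'w) measure) = index_space"
  unfolding pred_sigma_def index_space_def by (rule space_measure_of) auto

lemma pred_sigma_measurable:
  assumes "f \<in> measurable (pred_sigma TYPE('b::metric_space) M \<F> T) N"
  shows "f \<in> measurable predictable N"
proof (rule measurable_from_subalg[OF _ assms])
  show "subalgebra predictable (pred_sigma TYPE('b) M \<F> T)"
    unfolding subalgebra_def space_pred_sigma space_predictable using pred_sigma_subset by simp
qed

section \<open>The compensation formula\<close>

text \<open>A monotone class argument. Closure is required under complements of sets rather than under differences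
  of functions, because subtracting indicators keeps to finite values of the extended reals.\<close>

lemma predictable_induct [consumes 1, case_names cong rect compl add mult sup]:
  fixes h :: "real \<times> 'z \<times> 'w \<Rightarrow> ennreal"
  assumes h: "h \<in> borel_measurable predictable"
    and cong: "\<And>f g. (\<And>x. x \<in> index_space \<Longrightarrow> f x = g x) \<Longrightarrow> P g \<Longrightarrow> P f"
    and rect: "\<And>A. A \<in> rects \<Longrightarrow> P (indicator A)"
    and compl: "\<And>A. A \<in> sets predictable \<Longrightarrow> P (indicator A) \<Longrightarrow> P (indicator (index_space - A))"
    and add: "\<And>f g. f \<in> borel_measurable predictable \<Longrightarrow> g \<in> borel_measurable predictable \<Longrightarrow>
      P f \<Longrightarrow> P g \<Longrightarrow> P (\<lambda>x. f x + g x)"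
    and mult: "\<And>c f. f \<in> borel_measurable predictable \<Longrightarrow> P f \<Longrightarrow> P (\<lambda>x. c * f x)"
    and sup: "\<And>U. (\<And>i. U i \<in> borel_measurable predictable) \<Longrightarrow> incseq U \<Longrightarrow> (\<And>i. P (U i)) \<Longrightarrow>
      P (\<lambda>x. SUP i::nat. U i x)"
  shows "P h"
proof -
  have empty: "P (\<lambda>x. 0)" by (rule cong[OF _ rect[OF empty_rects]]) simp
  have ind: "P (indicator A)" if A: "A \<in> sets predictable" for A
  proof -
    have "A \<in> sigma_sets index_space rects" using A by (simp add: sets_predictable)
    with rects_Int_stable rects_subset show ?thesis
    proof (induction rule: sigma_sets_induct_disjoint)
      case (basic A)
      then show ?case by (rule rect)
    next
      case empty
      show ?case by (rule rect) (rule empty_rects)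
    next
      case (compl A)
      then show ?case by (intro assms(4)) (auto simp: sets_predictable)
    next
      case (union A)
      have [measurable]: "A i \<in> sets predictable" for i using union by (auto simp: sets_predictable)
      have "P (\<lambda>x. \<Sum>i<n. indicator (A i) x)" for n
      proof (induction n)
        case (Suc n)
        have "P (\<lambda>x. (\<Sum>i<n. indicator (A i) x) + indicator (A n) x)"
          by (rule add) (use Suc union in auto)
        then show ?case by simp
      qed (simp add: empty)
      then have "P (\<lambda>x. SUP n. \<Sum>i<n. indicator (A i) x)"
        by (intro sup) (auto intro!: monoI sum_mono2 simp: le_fun_def)
      then show ?case
        by (rule cong[rotated]) (simp add: suminf_indicator[OF union(1), symmetric] suminf_eq_SUP)
    qed
  qed
  show ?thesis using h
  proof (induction rule: borel_measurable_induct)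
    case (cong f g)
    then show ?case using assms(2)[of f g] by (simp add: space_predictable)
  next
    case (set A)
    then show ?case by (rule ind)
  next
    case (mult u c)
    then show ?case by (intro assms(6))
  next
    case (add u v)
    then show ?case using assms(5)[of v u] by (simp add: add.commute)
  next
    case (seq U)
    then have "P (\<lambda>x. SUP i. U i x)" by (intro sup) auto
    then show ?case by (simp add: SUP_apply[abs_def])
  qed
qed

definition jump_sum :: "(real \<times> 'z \<times> 'w \<Rightarrow> 'b::comm_monoid_add) \<Rightarrow> 'w \<Rightarrow> 'b" where
  "jump_sum h \<omega> = (\<Sum>s\<in>D \<omega>. h (s, q \<omega> s, \<omega>))"

definition horizon :: "real measure" where
  "horizon = restrict_space lborel {0..T}"

definition compensator :: "(real \<times> 'z \<times> 'w \<Rightarrow> ennreal) \<Rightarrow> 'w \<Rightarrow> ennreal" where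
  "compensator h \<omega> = (\<integral>\<^sup>+y. h (fst y, snd y, \<omega>) \<partial>(horizon \<Otimes>\<^sub>M \<nu>))"

lemma intensity_alt: "intensity = horizon \<Otimes>\<^sub>M (\<nu> \<Otimes>\<^sub>M M)"
  by (simp add: intensity_def horizon_def)

lemma jump_in_index_space: "\<omega> \<in> space M \<Longrightarrow> s \<in> D \<omega> \<Longrightarrow> (s, q \<omega> s, \<omega>) \<in> index_space"
  using jumps_subset[of \<omega>] by (auto simp: index_space_def)

lemma space_horizon: "space horizon = {0..T}"
  by (simp add: horizon_def space_restrict_space)

lemma emeasure_horizon: "A \<in> sets borel \<Longrightarrow> A \<subseteq> {0..T} \<Longrightarrow> emeasure horizon A = emeasure lborel A"
  by (simp add: horizon_def emeasure_restrict_space)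

lemma sets_horizon: "A \<in> sets borel \<Longrightarrow> A \<subseteq> {0..T} \<Longrightarrow> A \<in> sets horizon"
  by (simp add: horizon_def sets_restrict_space_iff)

lemma finite_horizon: "finite_measure horizon"
  using T_pos by (intro finite_measureI) (simp add: space_horizon emeasure_horizon)

lemma pair_sigma_finite_intensity:
  "sigma_finite_measure \<nu>" "sigma_finite_measure horizon"
  "pair_sigma_finite \<nu> M" "pair_sigma_finite horizon M" "pair_sigma_finite horizon \<nu>"
  "sigma_finite_measure (\<nu> \<Otimes>\<^sub>M M)" "sigma_finite_measure (horizon \<Otimes>\<^sub>M \<nu>)"
proof -
  interpret N: finite_measure \<nu> by (rule finite_intensity)
  interpret H: finite_measure horizon by (rule finite_horizon)
  interpret NM: pair_sigma_finite \<nu> M ..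
  interpret HN: pair_sigma_finite horizon \<nu> ..
  show "sigma_finite_measure \<nu>" "sigma_finite_measure horizon"
    "pair_sigma_finite \<nu> M" "pair_sigma_finite horizon M" "pair_sigma_finite horizon \<nu>" by unfold_locales
  show "sigma_finite_measure (\<nu> \<Otimes>\<^sub>M M)" "sigma_finite_measure (horizon \<Otimes>\<^sub>M \<nu>)" by unfold_locales
qed

lemma emeasure_intensity_rect:
  assumes "I \<in> sets horizon" "U \<in> sets borel" "B \<in> sets M"
  shows "emeasure intensity (I \<times> U \<times> B) = emeasure horizon I * (emeasure \<nu> U * emeasure M B)"
proof -
  interpret NM: sigma_finite_measure "\<nu> \<Otimes>\<^sub>M M" by (rule pair_sigma_finite_intensity)
  have "U \<times> B \<in> sets (\<nu> \<Otimes>\<^sub>M M)" using assms by (auto simp: sets_intensity)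
  then have "emeasure intensity (I \<times> U \<times> B) = emeasure horizon I * emeasure (\<nu> \<Otimes>\<^sub>M M) (U \<times> B)"
    unfolding intensity_alt using assms by (intro NM.emeasure_pair_measure_Times)
  also have "emeasure (\<nu> \<Otimes>\<^sub>M M) (U \<times> B) = emeasure \<nu> U * emeasure M B"
    using assms by (intro emeasure_pair_measure_Times) (auto simp: sets_intensity)
  finally show ?thesis .
qed

lemma finite_intensity_index_space: "emeasure intensity index_space < \<infinity>"
proof -
  interpret N: finite_measure \<nu> by (rule finite_intensity)
  show ?thesis unfolding index_space_def using T_pos
    by (subst emeasure_intensity_rect)
      (auto simp: sets_horizon emeasure_horizon emeasure_space_1 N.emeasure_finite ennreal_mult_eq_top_iff less_top[symmetric])
qed

lemma jump_sum_rect: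
  assumes "0 \<le> a" "a \<le> b" "b \<le> T" "U \<in> sets borel" "B \<in> sets (\<F> a)"
  shows "jump_sum (indicator ({a<..b} \<times> U \<times> B)) \<omega> =
    ennreal (real (card {s\<in>D \<omega>. a < s \<and> s \<le> b \<and> q \<omega> s \<in> U})) * indicator B \<omega>"
proof -
  have "jump_sum (indicator ({a<..b} \<times> U \<times> B)) \<omega> =
      (\<Sum>s\<in>D \<omega>. if a < s \<and> s \<le> b \<and> q \<omega> s \<in> U then indicator B \<omega> else 0 :: ennreal)"
    unfolding jump_sum_def by (intro sum.cong) (auto simp: indicator_def)
  also have "\<dots> = (\<Sum>s\<in>{s\<in>D \<omega>. a < s \<and> s \<le> b \<and> q \<omega> s \<in> U}. indicator B \<omega>)"
    using finite_jumps by (rule sum.inter_filter[symmetric])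
  finally show ?thesis by (simp add: ennreal_of_nat_eq_real_of_nat)
qed

text \<open>On a rectangle \<open>{a<..b} \<times> U \<times> B\<close> this is the martingale property of the compensated count of \<open>U\<close>,
  integrated over the event \<open>B\<close> known at time \<open>a\<close>. Complements are subtracted from the
  total number of points, which has finite expectation. Measurability in \<open>\<omega>\<close> is
  proved along with the formula because each closure step needs it.\<close>

theorem Campbell:
  assumes "h \<in> borel_measurable predictable"
  shows "jump_sum h \<in> borel_measurable M \<and>
    (\<integral>\<^sup>+\<omega>. jump_sum h \<omega> \<partial>M) = (\<integral>\<^sup>+x. h x \<partial>intensity)"
  using assms
proof (induction rule: predictable_induct)
  case (cong f g)
  have e: "jump_sum f \<omega> = jump_sum g \<omega>" if "\<omega> \<in> space M" for \<omega>
    unfolding jump_sum_def using that cong(1) by (intro sum.cong) (auto simp: jump_in_index_space)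
  have "(\<integral>\<^sup>+x. f x \<partial>intensity) = (\<integral>\<^sup>+x. g x \<partial>intensity)"
    using cong(1) by (intro nn_integral_cong) (simp add: space_intensity_measure)
  with e cong(2) show ?case by (simp cong: measurable_cong nn_integral_cong)
next
  case (rect A)
  then have Ai: "A \<in> sets intensity" using predictable_subset rects_predictable by blast
  from rect show ?case
  proof (cases rule: rects_cases)
    case (initial U B)
    have "{0} \<in> sets horizon" "emeasure horizon {0} = 0"
      using T_pos by (simp_all add: sets_horizon emeasure_horizon)
    moreover have "jump_sum (indicator A) = (\<lambda>\<omega>. 0 :: ennreal)"
    proof
      show "jump_sum (indicator A) \<omega> = (0 :: ennreal)" for \<omega>
        unfolding jump_sum_def using jumps_subset[of \<omega>] by (intro sum.neutral) (auto simp: initial)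
    qed
    ultimately show ?thesis
      using Ai initial sets_filtration[of 0] by (auto simp: emeasure_intensity_rect)
  next
    case (Ioc a b U B)
    show ?thesis
    proof (cases "a \<le> b")
      case False
      then have "A = {}" using Ioc by auto
      then show ?thesis by (simp add: jump_sum_def)
    next
      case True
      have B[measurable]: "B \<in> sets M" using Ioc sets_filtration[of a] by auto
      have js: "jump_sum (indicator A) = (\<lambda>\<omega>. ennreal (real (card {s\<in>D \<omega>. a < s \<and> s \<le> b \<and> q \<omega> s \<in> U})) * indicator B \<omega>)"
        using Ioc True by (simp add: jump_sum_rect fun_eq_iff)
      have [measurable]: "(\<lambda>\<omega>. real (card {s\<in>D \<omega>. a < s \<and> s \<le> b \<and> q \<omega> s \<in> U})) \<in> borel_measurable M"
        using Ioc True by (intro measurable_from_subalg[OF subalgebra_filtration adapted_count_Ioc]) auto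
      have "(jump_sum (indicator A) :: 'w \<Rightarrow> ennreal) \<in> borel_measurable M" unfolding js by measurable
      moreover have "(\<integral>\<^sup>+\<omega>. jump_sum (indicator A) \<omega> \<partial>M) = (\<integral>\<^sup>+x. indicator A x \<partial>intensity)"
        unfolding js using Ai Ioc True B
        by (simp add: count_compensator emeasure_intensity_rect sets_horizon emeasure_horizon mult.assoc subset_eq)
      ultimately show ?thesis by simp
    qed
  qed
next
  case (compl A)
  have A: "A \<in> sets intensity" "A \<subseteq> index_space"
    using compl predictable_subset sets.sets_into_space[OF compl(1)] by (auto simp: space_predictable)
  let ?J = "jump_sum (indicator A) :: 'w \<Rightarrow> ennreal" and ?C = "\<lambda>\<omega>. ennreal (real (card {s\<in>D \<omega>. 0 < s \<and> s \<le> T \<and> q \<omega> s \<in> UNIV}))"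
  have card: "{s\<in>D \<omega>. 0 < s \<and> s \<le> T \<and> q \<omega> s \<in> UNIV} = D \<omega>" for \<omega>
    using jumps_subset[of \<omega>] by auto
  have [measurable]: "?J \<in> borel_measurable M" using compl by simp
  have "(\<lambda>\<omega>. real (card {s\<in>D \<omega>. 0 < s \<and> s \<le> T \<and> q \<omega> s \<in> UNIV})) \<in> borel_measurable M"
    using T_pos by (intro measurable_from_subalg[OF subalgebra_filtration adapted_count_Ioc]) auto
  then have C[measurable]: "?C \<in> borel_measurable M" by measurable
  have diff: "jump_sum (indicator (index_space - A)) \<omega> = ?C \<omega> - ?J \<omega>" and le: "?J \<omega> \<le> ?C \<omega>" if \<omega>: "\<omega> \<in> space M" for \<omega>
  proof -
    have "jump_sum (indicator (index_space - A)) \<omega> + ?J \<omega> = (\<Sum>s\<in>D \<omega>. 1)"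
      unfolding jump_sum_def sum.distrib[symmetric]
      using jump_in_index_space[OF \<omega>] by (intro sum.cong) (auto simp: indicator_def)
    also have "\<dots> = ?C \<omega>" unfolding card by (simp add: ennreal_of_nat_eq_real_of_nat)
    finally have s: "jump_sum (indicator (index_space - A)) \<omega> + ?J \<omega> = ?C \<omega>" .
    then have J: "?J \<omega> \<le> ?C \<omega>" by (metis add.commute le_iff_add)
    then show "?J \<omega> \<le> ?C \<omega>" .
    have fin: "?J \<omega> \<noteq> \<top>" by (rule neq_top_trans[OF _ J]) simp
    show "jump_sum (indicator (index_space - A)) \<omega> = ?C \<omega> - ?J \<omega>"
      using s fin by (metis ennreal_add_diff_cancel_right)
  qed
  have CI: "(\<integral>\<^sup>+\<omega>. ?C \<omega> \<partial>M) = emeasure intensity index_space"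
  proof -
    have "(\<integral>\<^sup>+\<omega>. ?C \<omega> \<partial>M) = (\<integral>\<^sup>+\<omega>. ?C \<omega> * indicator (space M) \<omega> \<partial>M)" by (intro nn_integral_cong) simp
    also have "\<dots> = ennreal (T - 0) * emeasure \<nu> UNIV * emeasure M (space M)"
      using T_pos space_filtration[of 0] sets.top[of "\<F> 0"] by (intro count_compensator) auto
    also have "\<dots> = emeasure intensity index_space"
      unfolding index_space_def using T_pos
      by (subst emeasure_intensity_rect) (auto simp: sets_horizon emeasure_horizon emeasure_space_1)
    finally show ?thesis .
  qed
  have fin: "emeasure intensity A \<noteq> \<top>"
    using finite_intensity_index_space emeasure_mono[OF A(2), of intensity] sets.top[of intensity]
    by (auto simp: space_intensity_measure top_unique)
  have "jump_sum (indicator (index_space - A) :: _ \<Rightarrow> ennreal) \<in> borel_measurable M \<longleftrightarrow> (\<lambda>\<omega>. ?C \<omega> - ?J \<omega>) \<in> borel_measurable M"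
    by (rule measurable_cong) (rule diff)
  moreover have "(\<integral>\<^sup>+\<omega>. jump_sum (indicator (index_space - A)) \<omega> \<partial>M) = (\<integral>\<^sup>+\<omega>. ?C \<omega> - ?J \<omega> \<partial>M)"
    by (rule nn_integral_cong) (rule diff)
  moreover have "\<dots> = (\<integral>\<^sup>+\<omega>. ?C \<omega> \<partial>M) - (\<integral>\<^sup>+\<omega>. ?J \<omega> \<partial>M)"
  proof (rule nn_integral_diff)
    show "(\<integral>\<^sup>+\<omega>. ?J \<omega> \<partial>M) \<noteq> \<infinity>" using fin compl(2) A(1) by simp
    show "AE \<omega> in M. ?J \<omega> \<le> ?C \<omega>" using le by (rule AE_I2)
  qed (rule C, use compl in simp)
  moreover have "\<dots> = emeasure intensity (index_space - A)"
    unfolding CI using A fin sets.top[of intensity] compl(2)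
    by (subst emeasure_Diff) (auto simp: space_intensity_measure)
  moreover have "index_space - A \<in> sets intensity"
    using A sets.compl_sets[OF A(1)] by (simp add: space_intensity_measure)
  moreover have "(\<lambda>\<omega>. ?C \<omega> - ?J \<omega>) \<in> borel_measurable M"
    using C compl(2) by (intro borel_measurable_minus_ennreal) simp_all
  ultimately show ?case by simp
next
  case (add f g)
  have "jump_sum (\<lambda>x. f x + g x) = (\<lambda>\<omega>. jump_sum f \<omega> + jump_sum g \<omega>)"
    by (simp add: jump_sum_def sum.distrib fun_eq_iff)
  moreover have "(\<lambda>\<omega>. jump_sum f \<omega> + jump_sum g \<omega>) \<in> borel_measurable M"
    using add by (intro borel_measurable_add) auto
  ultimately show ?case using add by (simp add: nn_integral_add measurable_intensity)
next
  case (mult c f)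
  have "jump_sum (\<lambda>x. c * f x) = (\<lambda>\<omega>. c * jump_sum f \<omega>)"
    by (simp add: jump_sum_def sum_distrib_left fun_eq_iff)
  moreover have "(\<lambda>\<omega>. c * jump_sum f \<omega>) \<in> borel_measurable M"
    using mult by (intro borel_measurable_times_ennreal) auto
  ultimately show ?case using mult by (simp add: nn_integral_cmult measurable_intensity)
next
  case (sup U)
  have js: "jump_sum (\<lambda>x. SUP i. U i x) = (\<lambda>\<omega>. SUP i. jump_sum (U i) \<omega>)"
  proof
    fix \<omega>
    show "jump_sum (\<lambda>x. SUP i. U i x) \<omega> = (SUP i. jump_sum (U i) \<omega>)"
      unfolding jump_sum_def
      by (rule ennreal_SUP_sum[symmetric]) (use sup in \<open>auto simp: incseq_def le_fun_def\<close>)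
  qed
  have inc: "incseq (\<lambda>i. jump_sum (U i))"
    using sup(2) by (auto simp: incseq_def le_fun_def jump_sum_def intro!: sum_mono)
  have "(\<lambda>\<omega>. SUP i. jump_sum (U i) \<omega>) \<in> borel_measurable M"
    using sup by (intro borel_measurable_SUP) auto
  then show ?case unfolding js
    using sup inc by (simp add: nn_integral_monotone_convergence_SUP measurable_intensity)
qed

section \<open>Compensators and left limits of jump sums\<close>

lemma section_measurable:
  assumes h: "h \<in> measurable predictable N" and \<omega>: "\<omega> \<in> space M"
  shows "(\<lambda>y. h (fst y, snd y, \<omega>)) \<in> measurable (horizon \<Otimes>\<^sub>M \<nu>) N"
proof -
  have h': "h \<in> measurable (horizon \<Otimes>\<^sub>M (\<nu> \<Otimes>\<^sub>M M)) N"
    using measurable_intensity[OF h] by (simp add: intensity_alt)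
  have "(\<lambda>y. (fst y, snd y, \<omega>)) \<in> measurable (horizon \<Otimes>\<^sub>M \<nu>) (horizon \<Otimes>\<^sub>M (\<nu> \<Otimes>\<^sub>M M))"
    by (intro measurable_Pair measurable_fst measurable_snd measurable_const \<omega>)
  from measurable_compose[OF this h'] show ?thesis .
qed

lemma compensator_eq_iterated:
  assumes h: "h \<in> borel_measurable predictable" and \<omega>: "\<omega> \<in> space M"
  shows "compensator h \<omega> = (\<integral>\<^sup>+t\<in>{0..T}. (\<integral>\<^sup>+z. h (t, z, \<omega>) \<partial>\<nu>) \<partial>lborel)"
proof -
  interpret N: sigma_finite_measure \<nu> by (rule pair_sigma_finite_intensity)
  have "compensator h \<omega> = (\<integral>\<^sup>+t. (\<integral>\<^sup>+z. h (t, z, \<omega>) \<partial>\<nu>) \<partial>horizon)"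
    unfolding compensator_def using N.nn_integral_fst[OF section_measurable[OF h \<omega>]] by simp
  also have "\<dots> = (\<integral>\<^sup>+t\<in>{0..T}. (\<integral>\<^sup>+z. h (t, z, \<omega>) \<partial>\<nu>) \<partial>lborel)"
    unfolding horizon_def by (rule nn_integral_restrict_space) simp
  finally show ?thesis .
qed

lemma compensator_measurable_integral:
  assumes h: "h \<in> borel_measurable predictable"
  shows "compensator h \<in> borel_measurable M"
    and "(\<integral>\<^sup>+\<omega>. compensator h \<omega> \<partial>M) = (\<integral>\<^sup>+x. h x \<partial>intensity)"
proof -
  interpret N: sigma_finite_measure \<nu> by (rule pair_sigma_finite_intensity)
  interpret NM: pair_sigma_finite \<nu> M by (rule pair_sigma_finite_intensity)
  interpret HM: pair_sigma_finite horizon M by (rule pair_sigma_finite_intensity)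
  interpret NM': sigma_finite_measure "\<nu> \<Otimes>\<^sub>M M" by (rule pair_sigma_finite_intensity)
  interpret HN': sigma_finite_measure "horizon \<Otimes>\<^sub>M \<nu>" by (rule pair_sigma_finite_intensity)
  have [measurable]: "h \<in> borel_measurable (horizon \<Otimes>\<^sub>M (\<nu> \<Otimes>\<^sub>M M))"
    using measurable_intensity[OF h] by (simp add: intensity_alt)
  have m: "(\<lambda>(t, \<omega>). \<integral>\<^sup>+z. h (t, z, \<omega>) \<partial>\<nu>) \<in> borel_measurable (horizon \<Otimes>\<^sub>M M)"
    by measurable
  have fst: "compensator h \<omega> = (\<integral>\<^sup>+t. (\<integral>\<^sup>+z. h (t, z, \<omega>) \<partial>\<nu>) \<partial>horizon)" if "\<omega> \<in> space M" for \<omega>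
    unfolding compensator_def using N.nn_integral_fst[OF section_measurable[OF h that]] by simp
  show "compensator h \<in> borel_measurable M"
    unfolding compensator_def[abs_def] by measurable
  have "(\<integral>\<^sup>+x. h x \<partial>intensity) = (\<integral>\<^sup>+t. (\<integral>\<^sup>+y. h (t, y) \<partial>(\<nu> \<Otimes>\<^sub>M M)) \<partial>horizon)"
    unfolding intensity_alt by (rule sigma_finite_measure.nn_integral_fst[OF pair_sigma_finite_intensity(6), symmetric]) simp
  also have "\<dots> = (\<integral>\<^sup>+t. (\<integral>\<^sup>+\<omega>. (\<integral>\<^sup>+z. h (t, z, \<omega>) \<partial>\<nu>) \<partial>M) \<partial>horizon)"
    by (intro nn_integral_cong NM.nn_integral_snd[symmetric]) measurable
  also have "\<dots> = (\<integral>\<^sup>+\<omega>. (\<integral>\<^sup>+t. (\<integral>\<^sup>+z. h (t, z, \<omega>) \<partial>\<nu>) \<partial>horizon) \<partial>M)"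
    by (rule HM.Fubini'[symmetric, OF m])
  also have "\<dots> = (\<integral>\<^sup>+\<omega>. compensator h \<omega> \<partial>M)"
    by (intro nn_integral_cong) (simp add: fst)
  finally show "(\<integral>\<^sup>+\<omega>. compensator h \<omega> \<partial>M) = (\<integral>\<^sup>+x. h x \<partial>intensity)" by simp
qed

text \<open>The left limit at time \<open>t\<close> of the process that sums \<open>h\<close> over the points up to \<open>t\<close>, as a function on
  the same space as \<open>h\<close> that ignores the mark.\<close>

definition past_sum :: "(real \<times> 'z \<times> 'w \<Rightarrow> 'b::comm_monoid_add) \<Rightarrow> real \<times> 'z \<times> 'w \<Rightarrow> 'b" where
  "past_sum h x = (\<Sum>s\<in>{s\<in>D (snd (snd x)). s < fst x}. h (s, q (snd (snd x)) s, snd (snd x)))"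

text \<open>The count over points strictly before \<open>t\<close> is the limit of the counts up to the
  lagged times: on a path with finitely many points the two agree eventually.\<close>

lemma past_sum_rect_measurable:
  assumes a: "0 \<le> a" "b \<le> T" and U: "U \<in> sets borel" and B: "B \<in> sets (\<F> a)"
  shows "(\<lambda>(t, z, \<omega>). real (card {s\<in>D \<omega>. a < s \<and> s \<le> b \<and> s < t \<and> q \<omega> s \<in> U}) * indicator B \<omega>)
    \<in> borel_measurable predictable"
proof -
  define g :: "real \<times> 'z \<times> 'w \<Rightarrow> real" where
    "g = (\<lambda>(t, z, \<omega>). real (card {s\<in>D \<omega>. a < s \<and> s \<le> min b t \<and> q \<omega> s \<in> U}) * indicator B \<omega>)"
  show ?thesis
  proof (rule predictable_left_limit[where g = g])
    fix t assume t: "t \<in> {0..T}"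
    have "(\<lambda>\<omega>. real (card {s\<in>D \<omega>. a < s \<and> s \<le> min b t \<and> q \<omega> s \<in> U}) * indicator B \<omega>) \<in> borel_measurable (\<F> t)"
    proof (cases "a \<le> min b t")
      case True
      then have "B \<in> sets (\<F> t)" using filtration_mono[of a t] a B by auto
      moreover have "(\<lambda>\<omega>. real (card {s\<in>D \<omega>. a < s \<and> s \<le> min b t \<and> q \<omega> s \<in> U})) \<in> borel_measurable (\<F> t)"
      proof (rule measurable_from_subalg)
        show "subalgebra (\<F> t) (\<F> (min b t))"
          using True a t space_filtration[of t] space_filtration[of "min b t"] filtration_mono[of "min b t" t]
          by (auto simp: subalgebra_def)
        show "(\<lambda>\<omega>. real (card {s\<in>D \<omega>. a < s \<and> s \<le> min b t \<and> q \<omega> s \<in> U})) \<in> borel_measurable (\<F> (min b t))"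
          using True a t U by (intro adapted_count_Ioc) auto
      qed
      ultimately show ?thesis by (intro borel_measurable_times borel_measurable_indicator)
    next
      case False
      then have "{s\<in>D \<omega>. a < s \<and> s \<le> min b t \<and> q \<omega> s \<in> U} = {}" for \<omega> by auto
      then show ?thesis by (simp only: card.empty of_nat_0 mult_zero_left) simp
    qed
    from measurable_compose[OF measurable_snd this]
    show "(\<lambda>(z, \<omega>). g (t, z, \<omega>)) \<in> borel_measurable (borel \<Otimes>\<^sub>M \<F> t)"
      by (simp add: g_def split_def)
  next
    fix t z \<omega> assume t: "t \<in> {0..T}"
    have "\<forall>\<^sub>F n in sequentially. \<forall>s\<in>D \<omega>. s \<le> lag n t \<longleftrightarrow> s < t"
    proof (rule eventually_ball_finite[OF finite_jumps], rule ballI)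
      fix s assume s: "s \<in> D \<omega>"
      show "\<forall>\<^sub>F n in sequentially. (s \<le> lag n t) = (s < t)"
      proof (cases "0 < t")
        case True
        then have l: "lag n t < t" for n by (rule lag_less)
        show ?thesis
        proof (cases "s < t")
          case True
          have "(\<lambda>n. lag n t) \<longlonglongrightarrow> t" using lag_at_left[OF \<open>0 < t\<close>] by (simp add: filterlim_at)
          then have "\<forall>\<^sub>F n in sequentially. s < lag n t" using True by (rule order_tendstoD)
          then show ?thesis by eventually_elim (use True in auto)
        next
          case False
          then have "\<not> s \<le> lag n t" for n using l[of n] by linarith
          then show ?thesis using False by simp
        qed
      next
        case False
        then have "t = 0" using t by simp
        then show ?thesis using s jumps_subset[of \<omega>] by (auto simp: lag_0)
      qed
    qed
    then have "\<forall>\<^sub>F n in sequentially. g (lag n t, z, \<omega>) =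
        real (card {s\<in>D \<omega>. a < s \<and> s \<le> b \<and> s < t \<and> q \<omega> s \<in> U}) * indicator B \<omega>"
    proof eventually_elim
      case (elim n)
      then have "{s\<in>D \<omega>. a < s \<and> s \<le> min b (lag n t) \<and> q \<omega> s \<in> U} =
          {s\<in>D \<omega>. a < s \<and> s \<le> b \<and> s < t \<and> q \<omega> s \<in> U}" by auto
      then show ?case by (simp add: g_def)
    qed
    then show "(\<lambda>n. g (lag n t, z, \<omega>)) \<longlonglongrightarrow>
        (case (t, z, \<omega>) of (t, z, \<omega>) \<Rightarrow> real (card {s\<in>D \<omega>. a < s \<and> s \<le> b \<and> s < t \<and> q \<omega> s \<in> U}) * indicator B \<omega>)"
      by (simp add: tendsto_eventually)
  qed
qed

lemma past_sum_predictable: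
  fixes h :: "real \<times> 'z \<times> 'w \<Rightarrow> ennreal"
  assumes "h \<in> borel_measurable predictable"
  shows "past_sum h \<in> borel_measurable predictable"
  using assms
proof (induction rule: predictable_induct)
  case (cong f g)
  have "past_sum f x = past_sum g x" if "x \<in> space predictable" for x
    unfolding past_sum_def using that cong(1) jump_in_index_space[of "snd (snd x)"]
    by (intro sum.cong) (auto simp: space_predictable index_space_def)
  with cong(2) show ?case by (simp cong: measurable_cong)
next
  case (rect A)
  then show ?case
  proof (cases rule: rects_cases)
    case (initial U B)
    have "past_sum (indicator A) x = (0::ennreal)" for x
      unfolding past_sum_def using jumps_subset[of "snd (snd x)"]
      by (intro sum.neutral) (auto simp: initial)
    then have "past_sum (indicator A) = (\<lambda>x. 0 :: ennreal)" by (rule ext)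
    then show ?thesis by simp
  next
    case (Ioc a b U B)
    have "past_sum (indicator A) x = ennreal (case x of (t, z, \<omega>) \<Rightarrow>
        real (card {s\<in>D \<omega>. a < s \<and> s \<le> b \<and> s < t \<and> q \<omega> s \<in> U}) * indicator B \<omega>)" for x
    proof -
      obtain t z \<omega> where x: "x = (t, z, \<omega>)" by (cases x)
      have "past_sum (indicator A) x =
          (\<Sum>s\<in>{s\<in>D \<omega>. s < t}. if a < s \<and> s \<le> b \<and> q \<omega> s \<in> U then indicator B \<omega> else 0 :: ennreal)"
        unfolding past_sum_def x by (intro sum.cong) (auto simp: indicator_def Ioc)
      also have "\<dots> = (\<Sum>s\<in>{s\<in>{s\<in>D \<omega>. s < t}. a < s \<and> s \<le> b \<and> q \<omega> s \<in> U}. indicator B \<omega>)"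
        using finite_jumps by (intro sum.inter_filter[symmetric]) simp
      also have "{s\<in>{s\<in>D \<omega>. s < t}. a < s \<and> s \<le> b \<and> q \<omega> s \<in> U} =
          {s\<in>D \<omega>. a < s \<and> s \<le> b \<and> s < t \<and> q \<omega> s \<in> U}" by auto
      finally show ?thesis
        by (cases "\<omega> \<in> B") (simp_all add: x ennreal_of_nat_eq_real_of_nat)
    qed
    then have "past_sum (indicator A) = (\<lambda>x. ennreal (case x of (t, z, \<omega>) \<Rightarrow>
        real (card {s\<in>D \<omega>. a < s \<and> s \<le> b \<and> s < t \<and> q \<omega> s \<in> U}) * indicator B \<omega>))" by (rule ext)
    then show ?thesis
      using measurable_compose[OF past_sum_rect_measurable measurable_ennreal] Ioc by simp
  qed
next
  case (compl A)
  have total: "(past_sum (indicator index_space) :: _ \<Rightarrow> ennreal) \<in> borel_measurable predictable"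
  proof -
    have U: "UNIV \<in> sets (borel :: 'z measure)" "space M \<in> sets (\<F> 0)"
      using space_filtration[of 0] sets.top[of "\<F> 0"] by auto
    have eq: "past_sum (indicator index_space) x = ennreal (case x of (t, z, \<omega>) \<Rightarrow>
        real (card {s\<in>D \<omega>. 0 < s \<and> s \<le> T \<and> s < t \<and> q \<omega> s \<in> UNIV}) * indicator (space M) \<omega>)"
      if x: "x \<in> space predictable" for x
    proof -
      obtain t z \<omega> where x': "x = (t, z, \<omega>)" by (cases x)
      then have \<omega>: "\<omega> \<in> space M" using x by (auto simp: space_predictable index_space_def)
      have "past_sum (indicator index_space) x = (\<Sum>s\<in>{s\<in>D \<omega>. s < t}. 1 :: ennreal)"
        unfolding past_sum_def x' using jump_in_index_space[OF \<omega>] by (intro sum.cong) auto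
      moreover have "{s\<in>D \<omega>. 0 < s \<and> s \<le> T \<and> s < t \<and> q \<omega> s \<in> UNIV} = {s\<in>D \<omega>. s < t}"
        using jumps_subset[of \<omega>] by auto
      ultimately show ?thesis using \<omega> unfolding x' by (simp add: ennreal_of_nat_eq_real_of_nat)
    qed
    have m: "(\<lambda>x. ennreal (case x of (t, z, \<omega>) \<Rightarrow>
        real (card {s\<in>D \<omega>. 0 < s \<and> s \<le> T \<and> s < t \<and> q \<omega> s \<in> UNIV}) * indicator (space M) \<omega>))
        \<in> borel_measurable predictable"
      using U by (intro measurable_compose[OF past_sum_rect_measurable measurable_ennreal]) auto
    show ?thesis by (rule measurable_cong[THEN iffD2, OF eq m])
  qed
  have "past_sum (indicator (index_space - A)) x = past_sum (indicator index_space) x - (past_sum (indicator A) x :: ennreal)" for x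
  proof -
    have "past_sum (indicator (index_space - A)) x + past_sum (indicator A) x = (past_sum (indicator index_space) x :: ennreal)"
      unfolding past_sum_def sum.distrib[symmetric]
      using sets.sets_into_space[OF compl(1)] by (intro sum.cong) (auto simp: indicator_def space_predictable)
    moreover have "past_sum (indicator A) x \<le> (\<Sum>s\<in>{s\<in>D (snd (snd x)). s < fst x}. 1 :: ennreal)"
      unfolding past_sum_def by (intro sum_mono) (simp add: indicator_def)
    then have "past_sum (indicator A) x \<noteq> (\<top> :: ennreal)"
      using neq_top_trans[rotated] by fastforce
    ultimately show ?thesis by (metis ennreal_add_diff_cancel_right)
  qed
  then have "past_sum (indicator (index_space - A)) = (\<lambda>x. past_sum (indicator index_space) x - (past_sum (indicator A) x :: ennreal))"
    by (rule ext)
  then show ?case using borel_measurable_minus_ennreal[OF total compl(2)] by simp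
next
  case (add f g)
  have "past_sum (\<lambda>x. f x + g x) = (\<lambda>x. past_sum f x + past_sum g x)"
    by (simp add: past_sum_def sum.distrib fun_eq_iff)
  with add show ?case by (simp add: borel_measurable_add)
next
  case (mult c f)
  have "past_sum (\<lambda>x. c * f x) = (\<lambda>x. c * past_sum f x)"
    by (simp add: past_sum_def sum_distrib_left fun_eq_iff)
  with mult show ?case by (simp add: borel_measurable_times_ennreal)
next
  case (sup U)
  have "past_sum (\<lambda>x. SUP i. U i x) x = (SUP i. past_sum (U i) x)" for x
    unfolding past_sum_def
    by (rule ennreal_SUP_sum[symmetric]) (use sup in \<open>auto simp: incseq_def le_fun_def\<close>)
  then have "past_sum (\<lambda>x. SUP i. U i x) = (\<lambda>x. SUP i. past_sum (U i) x)" by (rule ext)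
  then show ?case using sup by (simp add: borel_measurable_SUP)
qed

end

section \<open>Second moments\<close>

text \<open>Adding a last term \<open>x\<close> to a sum \<open>S\<close> raises the truncated sum by at most \<open>x\<close>, hence its square by at most
  \<open>2 x min K S + x\<^sup>2\<close>. With \<open>K = \<infinity>\<close> this is the telescoping expansion of the square.\<close>

lemma square_truncated_sum_le:
  fixes a :: "real \<Rightarrow> ennreal"
  assumes "finite D"
  shows "(min K (\<Sum>s\<in>D. a s))\<^sup>2 \<le> (\<Sum>u\<in>D. 2 * a u * min K (\<Sum>s\<in>{s\<in>D. s < u}. a s) + (a u)\<^sup>2)"
  using assms
proof (induction rule: finite_linorder_max_induct)
  case empty
  then show ?case by simp
next
  case (insert b A)
  then have b: "b \<notin> A" by auto
  have past: "{s\<in>insert b A. s < u} = {s\<in>A. s < u}" if "u \<in> A" for u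
    using insert that by force
  have past_b: "{s\<in>insert b A. s < b} = A" using insert by auto
  let ?S = "\<Sum>s\<in>A. a s"
  have "min K (\<Sum>s\<in>insert b A. a s) \<le> min K ?S + a b"
    using insert b by (auto simp: min_def add.commute intro: order_trans)
  then have "(min K (\<Sum>s\<in>insert b A. a s))\<^sup>2 \<le> (min K ?S + a b)\<^sup>2" by (rule power_mono) simp
  also have "\<dots> = (2 * a b * min K ?S + (a b)\<^sup>2) + (min K ?S)\<^sup>2"
    by (simp add: power2_eq_square distrib_left distrib_right mult_2 ac_simps)
  also have "\<dots> \<le> (2 * a b * min K ?S + (a b)\<^sup>2) +
      (\<Sum>u\<in>A. 2 * a u * min K (\<Sum>s\<in>{s\<in>A. s < u}. a s) + (a u)\<^sup>2)"
    by (rule add_left_mono[OF insert.IH])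
  also have "\<dots> = (\<Sum>u\<in>insert b A. 2 * a u * min K (\<Sum>s\<in>{s\<in>insert b A. s < u}. a s) + (a u)\<^sup>2)"
  proof -
    have "(\<Sum>u\<in>A. 2 * a u * min K (\<Sum>s\<in>{s\<in>insert b A. s < u}. a s) + (a u)\<^sup>2) =
        (\<Sum>u\<in>A. 2 * a u * min K (\<Sum>s\<in>{s\<in>A. s < u}. a s) + (a u)\<^sup>2)"
      by (intro sum.cong refl) (simp only: past)
    then show ?thesis by (simp only: sum.insert[OF insert(1) b] past_b)
  qed
  finally show ?case .
qed

lemma ennreal_weighted_AM_GM:
  assumes "0 < c"
  shows "2 * x * y \<le> ennreal (1 / c) * y\<^sup>2 + ennreal c * x\<^sup>2"
proof (cases "x = \<infinity> \<or> y = \<infinity>")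
  case True
  then show ?thesis using assms by (auto simp: ennreal_mult_top power2_eq_square)
next
  case False
  then obtain u v where xy: "x = ennreal u" "y = ennreal v" "0 \<le> u" "0 \<le> v"
    by (metis ennreal_cases infinity_ennreal_def)
  have "0 \<le> (v - c * u)\<^sup>2 / c" using assms by simp
  also have "\<dots> = 1 / c * v\<^sup>2 + c * u\<^sup>2 - 2 * u * v"
    using assms by (simp add: power2_eq_square field_simps)
  finally have "ennreal (2 * u * v) \<le> ennreal (1 / c * v\<^sup>2 + c * u\<^sup>2)" by (intro ennreal_leI) simp
  also have "ennreal (2 * u * v) = 2 * x * y" using xy by (simp add: ennreal_mult)
  also have "ennreal (1 / c * v\<^sup>2 + c * u\<^sup>2) = ennreal (1 / c) * y\<^sup>2 + ennreal c * x\<^sup>2"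
    using assms unfolding xy ennreal_power[OF xy(3)] ennreal_power[OF xy(4)]
    by (subst ennreal_plus) (simp_all only: ennreal_mult'[of "1 / c"] ennreal_mult'[of c] divide_nonneg_pos
        less_imp_le zero_le_one mult_nonneg_nonneg zero_le_power2)
  finally show ?thesis .
qed

lemma ennreal_absorb_half:
  assumes "I \<noteq> \<top>" "I \<le> ennreal (1 / 2) * I + K"
  shows "I \<le> 2 * K"
proof (cases "K = \<top>")
  case True
  then show ?thesis by (simp add: ennreal_mult_top)
next
  case False
  obtain i where i: "I = ennreal i" "0 \<le> i" using assms(1) by (cases I) auto
  obtain k where k: "K = ennreal k" "0 \<le> k" using False by (cases K) auto
  have "ennreal (1 / 2 * i + k) = ennreal (1 / 2) * ennreal i + ennreal k"
    using i k ennreal_mult'[of "1 / 2" i] by (subst ennreal_plus) auto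
  then have "ennreal i \<le> ennreal (1 / 2 * i + k)" using assms(2) unfolding i k by (simp only:)
  then have "i \<le> 1 / 2 * i + k" using i k by (subst (asm) ennreal_le_iff) auto
  then have "ennreal i \<le> ennreal (2 * k)" by (intro ennreal_leI) simp
  then show ?thesis using i k by (simp add: ennreal_mult')
qed

lemma SUP_min_of_nat_square: "(SUP n. (min (of_nat n) y)\<^sup>2) = (y :: ennreal)\<^sup>2"
proof (rule antisym)
  show "(SUP n. (min (of_nat n) y)\<^sup>2) \<le> y\<^sup>2" by (intro SUP_least power_mono) auto
  show "y\<^sup>2 \<le> (SUP n. (min (of_nat n) y)\<^sup>2)"
  proof (cases "y = \<top>")
    case True
    have "(SUP n. of_nat n :: ennreal) \<le> (SUP n. (min (of_nat n) y)\<^sup>2)"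
    proof (rule SUP_mono)
      fix n :: nat
      have "n \<le> n\<^sup>2" by (simp add: power2_eq_square)
      then have "(of_nat n :: ennreal) \<le> (of_nat n)\<^sup>2" by (metis of_nat_le_iff of_nat_power)
      then show "\<exists>m\<in>UNIV. (of_nat n :: ennreal) \<le> (min (of_nat m) y)\<^sup>2" using True by auto
    qed
    then have "(SUP n. (min (of_nat n) y)\<^sup>2) = \<top>"
      unfolding ennreal_SUP_of_nat_eq_top top_unique .
    then show ?thesis by (simp only: top_greatest)
  next
    case False
    then obtain n :: nat where "y < of_nat n" using ennreal_Ex_less_of_nat less_top by blast
    then have "y\<^sup>2 = (min (of_nat n) y)\<^sup>2" by (simp add: min_absorb2)
    also have "\<dots> \<le> (SUP n. (min (of_nat n) y)\<^sup>2)" by (rule SUP_upper) simp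
    finally show ?thesis .
  qed
qed

context marked_jumps
begin

definition total_mass :: real where
  "total_mass = T * measure \<nu> UNIV"

lemma total_mass: "emeasure (horizon \<Otimes>\<^sub>M \<nu>) (space (horizon \<Otimes>\<^sub>M \<nu>)) = ennreal total_mass" "0 \<le> total_mass"
proof -
  interpret N: finite_measure \<nu> by (rule finite_intensity)
  show "emeasure (horizon \<Otimes>\<^sub>M \<nu>) (space (horizon \<Otimes>\<^sub>M \<nu>)) = ennreal total_mass"
    using T_pos unfolding space_pair_measure total_mass_def
    by (subst N.emeasure_pair_measure_Times)
      (auto simp: space_intensity space_horizon emeasure_horizon sets_horizon sets_intensity N.emeasure_eq_measure ennreal_mult)
  show "0 \<le> total_mass" using T_pos by (simp add: total_mass_def)
qed

text \<open>The truncation at \<open>n\<close> is there only to make the second moment finite, so that half of it can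
  be subtracted. It also has to be applied to the left limit, since the weighted inequality
  between geometric and arithmetic mean must reproduce the very quantity that is absorbed.\<close>

lemma truncated_second_moment:
  fixes h :: "real \<times> 'z \<times> 'w \<Rightarrow> ennreal"
  assumes h[measurable]: "h \<in> borel_measurable predictable"
  shows "(\<integral>\<^sup>+\<omega>. (min (of_nat n) (jump_sum h \<omega>))\<^sup>2 \<partial>M) \<le>
    2 * (ennreal (2 * total_mass + 3) * (\<integral>\<^sup>+x. (h x)\<^sup>2 \<partial>intensity))"
proof (rule ennreal_absorb_half)
  define Y where "Y \<omega> = min (of_nat n) (jump_sum h \<omega>)" for \<omega>
  \<comment> \<open>twice the total mass, plus a margin that keeps \<open>c\<close> positive when \<open>\<nu> = 0\<close>\<close>
  define c where "c = 2 * (total_mass + 1)"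
  have c: "0 < c" "1 / c * total_mass \<le> 1 / 2"
    using total_mass(2) by (auto simp: c_def field_simps)
  have js: "jump_sum h \<in> borel_measurable M" using Campbell[OF h] by blast
  then have Y[measurable]: "Y \<in> borel_measurable M" unfolding Y_def[abs_def] by measurable
  have [measurable]: "past_sum h \<in> borel_measurable predictable" by (rule past_sum_predictable[OF h])
  define k where "k x = 2 * h x * min (of_nat n) (past_sum h x) + (h x)\<^sup>2" for x
  have k[measurable]: "k \<in> borel_measurable predictable" unfolding k_def[abs_def] by measurable
  have h2[measurable]: "(\<lambda>x. (h x)\<^sup>2) \<in> borel_measurable predictable" by measurable
  have "(\<integral>\<^sup>+\<omega>. (Y \<omega>)\<^sup>2 \<partial>M) \<le> (\<integral>\<^sup>+\<omega>. of_nat n ^ 2 \<partial>M)"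
    by (intro nn_integral_mono power_mono) (auto simp: Y_def)
  also have "\<dots> < \<top>" by (simp add: emeasure_space_1 ennreal_of_nat_eq_real_of_nat ennreal_power)
  finally show "(\<integral>\<^sup>+\<omega>. (min (of_nat n) (jump_sum h \<omega>))\<^sup>2 \<partial>M) \<noteq> \<top>" by (simp add: Y_def)
  have "(\<integral>\<^sup>+\<omega>. (Y \<omega>)\<^sup>2 \<partial>M) \<le> (\<integral>\<^sup>+\<omega>. jump_sum k \<omega> \<partial>M)"
  proof (rule nn_integral_mono)
    fix \<omega>
    show "(Y \<omega>)\<^sup>2 \<le> jump_sum k \<omega>"
      using square_truncated_sum_le[OF finite_jumps, of "of_nat n" "\<lambda>s. h (s, q \<omega> s, \<omega>)" \<omega>]
      by (simp add: Y_def jump_sum_def k_def past_sum_def)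
  qed
  also have "\<dots> = (\<integral>\<^sup>+\<omega>. compensator k \<omega> \<partial>M)"
    using Campbell[OF k] compensator_measurable_integral(2)[OF k] by simp
  also have "\<dots> \<le> (\<integral>\<^sup>+\<omega>. ennreal (1 / 2) * (Y \<omega>)\<^sup>2 + ennreal (c + 1) * compensator (\<lambda>x. (h x)\<^sup>2) \<omega> \<partial>M)"
  proof (rule nn_integral_mono)
    fix \<omega> assume \<omega>: "\<omega> \<in> space M"
    have past: "past_sum h (t, z, \<omega>) \<le> jump_sum h \<omega>" for t z
      unfolding past_sum_def jump_sum_def using finite_jumps by (simp add: sum_mono2)
    have kle: "k (t, z, \<omega>) \<le> ennreal (1 / c) * (Y \<omega>)\<^sup>2 + ennreal (c + 1) * (h (t, z, \<omega>))\<^sup>2" for t z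
    proof -
      have "k (t, z, \<omega>) \<le> 2 * h (t, z, \<omega>) * Y \<omega> + (h (t, z, \<omega>))\<^sup>2"
        unfolding k_def Y_def using past[of t z] by (intro add_right_mono mult_left_mono min.mono) auto
      also have "\<dots> \<le> ennreal (1 / c) * (Y \<omega>)\<^sup>2 + ennreal c * (h (t, z, \<omega>))\<^sup>2 + (h (t, z, \<omega>))\<^sup>2"
        by (intro add_right_mono ennreal_weighted_AM_GM c)
      also have "\<dots> = ennreal (1 / c) * (Y \<omega>)\<^sup>2 + ennreal (c + 1) * (h (t, z, \<omega>))\<^sup>2"
        using c by (simp add: ennreal_plus distrib_right add.assoc)
      finally show ?thesis .
    qed
    note sec = section_measurable[OF h2 \<omega>]
    have "compensator k \<omega> \<le>
        (\<integral>\<^sup>+y. ennreal (1 / c) * (Y \<omega>)\<^sup>2 + ennreal (c + 1) * (h (fst y, snd y, \<omega>))\<^sup>2 \<partial>(horizon \<Otimes>\<^sub>M \<nu>))"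
      unfolding compensator_def by (intro nn_integral_mono kle)
    also have "\<dots> = ennreal (1 / c) * (Y \<omega>)\<^sup>2 * ennreal total_mass + ennreal (c + 1) * compensator (\<lambda>x. (h x)\<^sup>2) \<omega>"
      unfolding compensator_def using sec
      by (subst nn_integral_add) (simp_all add: nn_integral_cmult total_mass)
    also have "\<dots> \<le> ennreal (1 / 2) * (Y \<omega>)\<^sup>2 + ennreal (c + 1) * compensator (\<lambda>x. (h x)\<^sup>2) \<omega>"
    proof (rule add_right_mono)
      have split: "ennreal (1 / c * total_mass) = ennreal (1 / c) * ennreal total_mass"
        using c by (intro ennreal_mult') simp
      have "ennreal (1 / c) * (Y \<omega>)\<^sup>2 * ennreal total_mass = ennreal (1 / c * total_mass) * (Y \<omega>)\<^sup>2"
        unfolding split by (simp only: ac_simps)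
      also have "\<dots> \<le> ennreal (1 / 2) * (Y \<omega>)\<^sup>2" using c by (intro mult_right_mono ennreal_leI) auto
      finally show "ennreal (1 / c) * (Y \<omega>)\<^sup>2 * ennreal total_mass \<le> ennreal (1 / 2) * (Y \<omega>)\<^sup>2" .
    qed
    finally show "compensator k \<omega> \<le> ennreal (1 / 2) * (Y \<omega>)\<^sup>2 + ennreal (c + 1) * compensator (\<lambda>x. (h x)\<^sup>2) \<omega>" .
  qed
  also have "\<dots> = ennreal (1 / 2) * (\<integral>\<^sup>+\<omega>. (Y \<omega>)\<^sup>2 \<partial>M) + ennreal (c + 1) * (\<integral>\<^sup>+x. (h x)\<^sup>2 \<partial>intensity)"
    using compensator_measurable_integral[OF h2]
    by (subst nn_integral_add) (simp_all add: nn_integral_cmult)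
  also have "c + 1 = 2 * total_mass + 3" by (simp add: c_def)
  finally show "(\<integral>\<^sup>+\<omega>. (min (of_nat n) (jump_sum h \<omega>))\<^sup>2 \<partial>M) \<le>
      ennreal (1 / 2) * (\<integral>\<^sup>+\<omega>. (min (of_nat n) (jump_sum h \<omega>))\<^sup>2 \<partial>M) +
      ennreal (2 * total_mass + 3) * (\<integral>\<^sup>+x. (h x)\<^sup>2 \<partial>intensity)"
    by (simp add: Y_def)
qed

text \<open>Monotone convergence removes the truncation, as its bound does not depend on the level.\<close>

theorem jump_sum_second_moment:
  fixes h :: "real \<times> 'z \<times> 'w \<Rightarrow> ennreal"
  assumes h: "h \<in> borel_measurable predictable"
  shows "(\<integral>\<^sup>+\<omega>. (jump_sum h \<omega>)\<^sup>2 \<partial>M) \<le> 2 * (ennreal (2 * total_mass + 3) * (\<integral>\<^sup>+x. (h x)\<^sup>2 \<partial>intensity))"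
proof -
  have [measurable]: "jump_sum h \<in> borel_measurable M" using Campbell[OF h] by blast
  have "(\<integral>\<^sup>+\<omega>. (jump_sum h \<omega>)\<^sup>2 \<partial>M) = (\<integral>\<^sup>+\<omega>. (SUP n. (min (of_nat n) (jump_sum h \<omega>))\<^sup>2) \<partial>M)"
    by (simp add: SUP_min_of_nat_square)
  also have "\<dots> = (SUP n. \<integral>\<^sup>+\<omega>. (min (of_nat n) (jump_sum h \<omega>))\<^sup>2 \<partial>M)"
  proof (rule nn_integral_monotone_convergence_SUP)
    show "incseq (\<lambda>n \<omega>. (min (of_nat n) (jump_sum h \<omega>))\<^sup>2)"
      by (auto simp: incseq_def le_fun_def intro!: power_mono min.mono)
  qed measurable
  also have "\<dots> \<le> 2 * (ennreal (2 * total_mass + 3) * (\<integral>\<^sup>+x. (h x)\<^sup>2 \<partial>intensity))"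
    by (rule SUP_least) (rule truncated_second_moment[OF h])
  finally show ?thesis .
qed

lemma compensator_second_moment:
  assumes h: "h \<in> borel_measurable predictable"
  shows "(\<integral>\<^sup>+\<omega>. (compensator h \<omega>)\<^sup>2 \<partial>M) \<le> ennreal total_mass * (\<integral>\<^sup>+x. (h x)\<^sup>2 \<partial>intensity)"
proof -
  have h2: "(\<lambda>x. (h x)\<^sup>2) \<in> borel_measurable predictable" using h by measurable
  have "(\<integral>\<^sup>+\<omega>. (compensator h \<omega>)\<^sup>2 \<partial>M) \<le> (\<integral>\<^sup>+\<omega>. ennreal total_mass * compensator (\<lambda>x. (h x)\<^sup>2) \<omega> \<partial>M)"
  proof (rule nn_integral_mono)
    fix \<omega> assume \<omega>: "\<omega> \<in> space M"
    have "(compensator h \<omega>)\<^sup>2 = (\<integral>\<^sup>+y. h (fst y, snd y, \<omega>) * 1 \<partial>(horizon \<Otimes>\<^sub>M \<nu>))\<^sup>2"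
      by (simp add: compensator_def)
    also have "\<dots> \<le> (\<integral>\<^sup>+y. (h (fst y, snd y, \<omega>))\<^sup>2 \<partial>(horizon \<Otimes>\<^sub>M \<nu>)) * (\<integral>\<^sup>+y. 1 ^ 2 \<partial>(horizon \<Otimes>\<^sub>M \<nu>))"
      using section_measurable[OF h \<omega>] by (intro Cauchy_Schwarz_nn_integral) auto
    finally show "(compensator h \<omega>)\<^sup>2 \<le> ennreal total_mass * compensator (\<lambda>x. (h x)\<^sup>2) \<omega>"
      by (simp add: total_mass compensator_def mult.commute)
  qed
  also have "\<dots> = ennreal total_mass * (\<integral>\<^sup>+x. (h x)\<^sup>2 \<partial>intensity)"
    using compensator_measurable_integral[OF h2] by (simp add: nn_integral_cmult)
  finally show ?thesis .
qed

corollary dominating_variable_L2: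
  assumes h: "h \<in> borel_measurable predictable" and fin: "(\<integral>\<^sup>+x. (h x)\<^sup>2 \<partial>intensity) < \<infinity>"
  shows "(\<integral>\<^sup>+\<omega>. (jump_sum h \<omega> + compensator h \<omega>)\<^sup>2 \<partial>M) < \<infinity>"
proof -
  have [measurable]: "jump_sum h \<in> borel_measurable M" "compensator h \<in> borel_measurable M"
    using Campbell[OF h] compensator_measurable_integral[OF h] by auto
  have "(a + b)\<^sup>2 \<le> 2 * a\<^sup>2 + 2 * b\<^sup>2" for a b :: ennreal
  proof -
    have "2 * a * b = a * b + a * b" by (simp only: mult_2 distrib_right)
    then have "(a + b)\<^sup>2 = a\<^sup>2 + b\<^sup>2 + 2 * a * b"
      by (simp only: power2_eq_square distrib_left distrib_right ac_simps)
    also have "\<dots> \<le> a\<^sup>2 + b\<^sup>2 + (b\<^sup>2 + a\<^sup>2)"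
      using ennreal_weighted_AM_GM[of 1 a b] by (intro add_left_mono) simp
    finally show ?thesis by (simp add: mult_2 ac_simps)
  qed
  then have "(\<integral>\<^sup>+\<omega>. (jump_sum h \<omega> + compensator h \<omega>)\<^sup>2 \<partial>M) \<le>
      (\<integral>\<^sup>+\<omega>. 2 * (jump_sum h \<omega>)\<^sup>2 + 2 * (compensator h \<omega>)\<^sup>2 \<partial>M)"
    by (intro nn_integral_mono)
  also have "\<dots> = 2 * (\<integral>\<^sup>+\<omega>. (jump_sum h \<omega>)\<^sup>2 \<partial>M) + 2 * (\<integral>\<^sup>+\<omega>. (compensator h \<omega>)\<^sup>2 \<partial>M)"
    by (subst nn_integral_add) (simp_all add: nn_integral_cmult)
  also have "\<dots> < \<infinity>"
  proof -
    have "(\<integral>\<^sup>+\<omega>. (jump_sum h \<omega>)\<^sup>2 \<partial>M) < \<infinity>"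
      using fin by (intro le_less_trans[OF jump_sum_second_moment[OF h]]) (simp add: ennreal_mult_less_top)
    moreover have "(\<integral>\<^sup>+\<omega>. (compensator h \<omega>)\<^sup>2 \<partial>M) < \<infinity>"
      using fin by (intro le_less_trans[OF compensator_second_moment[OF h]]) (simp add: ennreal_mult_less_top)
    ultimately show ?thesis by (simp add: ennreal_mult_less_top)
  qed
  finally show ?thesis .
qed

section \<open>Vector-valued integrands\<close>

text \<open>The intensity does not charge the set where \<open>g > h\<close>, and by Campbell's formula almost no path has
  a jump in it.\<close>

lemma domination_transfer:
  assumes g: "g \<in> borel_measurable predictable" and h: "h \<in> borel_measurable predictable"
    and le: "AE x in intensity. g x \<le> h x"
  shows "AE \<omega> in M. jump_sum g \<omega> \<le> jump_sum h \<omega> \<and> compensator g \<omega> \<le> compensator h \<omega>"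
proof -
  \<comment> \<open>not the difference \<open>g - h\<close>, which is infinite where both functions are\<close>
  define e where "e x = (if g x \<le> h x then 0 else g x)" for x
  have e: "e \<in> borel_measurable predictable" unfolding e_def[abs_def] using g h by measurable
  have "(\<integral>\<^sup>+x. e x \<partial>intensity) = (\<integral>\<^sup>+x. 0 \<partial>intensity)"
    by (rule nn_integral_cong_AE) (use le in \<open>eventually_elim, simp add: e_def\<close>)
  then have "(\<integral>\<^sup>+x. e x \<partial>intensity) = 0" by simp
  then have "(\<integral>\<^sup>+\<omega>. jump_sum e \<omega> \<partial>M) = 0" "(\<integral>\<^sup>+\<omega>. compensator e \<omega> \<partial>M) = 0"
    using Campbell[OF e] compensator_measurable_integral[OF e] by auto
  then have "AE \<omega> in M. jump_sum e \<omega> = 0" "AE \<omega> in M. compensator e \<omega> = 0"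
    using Campbell[OF e] compensator_measurable_integral(1)[OF e]
      nn_integral_0_iff_AE[of "jump_sum e" M] nn_integral_0_iff_AE[of "compensator e" M] by blast+
  with AE_space show ?thesis
  proof eventually_elim
    case (elim \<omega>)
    have le: "g x \<le> h x + e x" for x by (simp add: e_def)
    have "jump_sum g \<omega> \<le> jump_sum h \<omega> + jump_sum e \<omega>"
      unfolding jump_sum_def sum.distrib[symmetric] by (intro sum_mono le)
    moreover have "compensator g \<omega> \<le> compensator h \<omega> + compensator e \<omega>"
      unfolding compensator_def
      using section_measurable[OF h] section_measurable[OF e] elim
      by (subst nn_integral_add[symmetric]) (auto intro!: nn_integral_mono le)
    ultimately show ?case using elim by simp
  qed
qed

text \<open>For a simple integrand the sum is a combination of the numbers of jumps in its level sets,
  which are measurable by Campbell's formula; a finite sum commutes with pointwise limits.\<close>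

lemma jump_sum_measurable:
  fixes f :: "real \<times> 'z \<times> 'w \<Rightarrow> 'b::{banach,second_countable_topology}"
  assumes f: "f \<in> borel_measurable predictable"
  shows "jump_sum f \<in> borel_measurable M"
proof -
  obtain F where F: "\<And>i. simple_function predictable (F i)"
      "\<And>x. x \<in> index_space \<Longrightarrow> (\<lambda>i. F i x) \<longlonglongrightarrow> f x"
    using borel_measurable_implies_sequence_metric[OF f, of 0] by (auto simp: space_predictable)
  show ?thesis
  proof (rule borel_measurable_LIMSEQ_metric)
    fix i
    let ?A = "\<lambda>y. {x\<in>index_space. F i x = y}"
    have fin: "finite (F i ` index_space)" and A: "?A y \<in> sets predictable" for y
    proof -
      show "finite (F i ` index_space)" using simple_functionD(1)[OF F(1)] by (simp add: space_predictable)
      have "F i -` {y} \<inter> index_space = ?A y" by auto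
      then show "?A y \<in> sets predictable" using simple_functionD(2)[OF F(1), of i "{y}"] by (simp add: space_predictable)
    qed
    have "jump_sum (F i) \<omega> = (\<Sum>y\<in>F i ` index_space. enn2real (jump_sum (indicator (?A y)) \<omega>) *\<^sub>R y)"
      if \<omega>: "\<omega> \<in> space M" for \<omega>
    proof -
      have "jump_sum (indicator (?A y)) \<omega> = ennreal (\<Sum>s\<in>D \<omega>. indicator (?A y) (s, q \<omega> s, \<omega>))" for y
        unfolding jump_sum_def using sum_ennreal[of "D \<omega>" "\<lambda>s. indicator (?A y) (s, q \<omega> s, \<omega>)"]
        by (simp add: ennreal_indicator)
      then have "(\<Sum>y\<in>F i ` index_space. enn2real (jump_sum (indicator (?A y)) \<omega>) *\<^sub>R y) =
          (\<Sum>y\<in>F i ` index_space. \<Sum>s\<in>D \<omega>. indicator (?A y) (s, q \<omega> s, \<omega>) *\<^sub>R y)"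
        by (simp add: sum_nonneg scaleR_sum_left)
      also have "\<dots> = (\<Sum>s\<in>D \<omega>. \<Sum>y\<in>F i ` index_space. indicator (?A y) (s, q \<omega> s, \<omega>) *\<^sub>R y)"
        by (rule sum.swap)
      also have "\<dots> = jump_sum (F i) \<omega>"
        unfolding jump_sum_def
      proof (rule sum.cong[OF refl])
        fix s assume "s \<in> D \<omega>"
        then have b: "(s, q \<omega> s, \<omega>) \<in> index_space" using \<omega> by (rule jump_in_index_space[rotated])
        have "(\<Sum>y\<in>F i ` index_space. indicator (?A y) (s, q \<omega> s, \<omega>) *\<^sub>R y) =
            (\<Sum>y\<in>F i ` index_space. if y = F i (s, q \<omega> s, \<omega>) then y else 0)"
          using b by (intro sum.cong) (auto simp: indicator_def)
        also have "\<dots> = F i (s, q \<omega> s, \<omega>)" using fin b by simp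
        finally show "(\<Sum>y\<in>F i ` index_space. indicator (?A y) (s, q \<omega> s, \<omega>) *\<^sub>R y) = F i (s, q \<omega> s, \<omega>)" .
      qed
      finally show ?thesis by simp
    qed
    moreover have "(\<lambda>\<omega>. \<Sum>y\<in>F i ` index_space. enn2real (jump_sum (indicator (?A y)) \<omega>) *\<^sub>R y) \<in> borel_measurable M"
    proof (rule borel_measurable_sum)
      fix y
      have "jump_sum (indicator (?A y) :: _ \<Rightarrow> ennreal) \<in> borel_measurable M"
        using Campbell[of "indicator (?A y)"] A by (auto intro: borel_measurable_indicator)
      then show "(\<lambda>\<omega>. enn2real (jump_sum (indicator (?A y)) \<omega>) *\<^sub>R y) \<in> borel_measurable M" by measurable
    qed
    ultimately show "jump_sum (F i) \<in> borel_measurable M" by (simp cong: measurable_cong)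
  next
    fix \<omega> assume "\<omega> \<in> space M"
    then show "(\<lambda>i. jump_sum (F i) \<omega>) \<longlonglongrightarrow> jump_sum f \<omega>"
      unfolding jump_sum_def by (intro tendsto_sum F(2)) (rule jump_in_index_space)
  qed
qed

end

lemma norm_integral_le_nn_integral:
  fixes f :: "'a \<Rightarrow> 'b::{banach,second_countable_topology}"
  shows "ennreal (norm (integral\<^sup>L M f)) \<le> (\<integral>\<^sup>+x. ennreal (norm (f x)) \<partial>M)"
  by (cases "integrable M f") (simp_all add: integral_norm_bound_ennreal not_integrable_integral_eq)

context marked_jumps
begin

text \<open>The intensity lives on \<open>[0,T]\<close>, while the drift integral is taken over the whole time
  axis; the extension by zero makes Fubini's theorem applicable there.\<close>

lemma measurable_extend_by_zero:
  fixes f :: "real \<times> 'z \<times> 'w \<Rightarrow> 'b::{banach,second_countable_topology}"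
  assumes f: "f \<in> borel_measurable predictable"
  shows "(\<lambda>x. if fst x \<in> {0..T} then f x else 0) \<in> borel_measurable (lborel \<Otimes>\<^sub>M (\<nu> \<Otimes>\<^sub>M M))"
proof -
  let ?S = "lborel \<Otimes>\<^sub>M (\<nu> \<Otimes>\<^sub>M M)"
  have sp: "space ?S = UNIV \<times> UNIV \<times> space M" by (simp add: space_pair_measure space_intensity)
  have b: "index_space \<in> sets ?S"
    unfolding index_space_def by (intro pair_measureI) (auto simp: sets_intensity)
  have "(\<lambda>x. (fst x, snd x)) \<in> measurable (restrict_space ?S index_space) (horizon \<Otimes>\<^sub>M (\<nu> \<Otimes>\<^sub>M M))"
  proof (rule measurable_Pair)
    show "fst \<in> measurable (restrict_space ?S index_space) horizon"
      unfolding horizon_def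
      by (intro measurable_restrict_space2 measurable_restrict_space1 measurable_fst)
        (auto simp: space_restrict_space index_space_def)
    show "snd \<in> measurable (restrict_space ?S index_space) (\<nu> \<Otimes>\<^sub>M M)"
      by (intro measurable_restrict_space1 measurable_snd)
  qed
  then have "(\<lambda>x. x) \<in> measurable (restrict_space ?S index_space) intensity" by (simp add: intensity_alt)
  from measurable_compose[OF this measurable_intensity[OF f]]
  have "f \<in> borel_measurable (restrict_space ?S index_space)" .
  then have "(\<lambda>x. if x \<in> index_space then f x else 0) \<in> borel_measurable ?S"
    using b by (subst (asm) measurable_restrict_space_iff[where c=0]) auto
  then show ?thesis
    by (rule measurable_cong[THEN iffD1, rotated]) (auto simp: sp index_space_def)
qed

lemma integrand_section_measurable:
  fixes f :: "real \<times> 'z \<times> 'w \<Rightarrow> 'b::{banach,second_countable_topology}"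
  assumes f: "f \<in> borel_measurable predictable" and t: "t \<le> T"
  shows "(\<lambda>(\<omega>, y). indicator ({0<..t} \<times> UNIV) y *\<^sub>R f (fst y, snd y, \<omega>))
    \<in> borel_measurable (M \<Otimes>\<^sub>M (lborel \<Otimes>\<^sub>M \<nu>))"
proof -
  define G where "G = (\<lambda>x. if fst x \<in> {0..T} then f x else 0)"
  have G[measurable]: "G \<in> borel_measurable (lborel \<Otimes>\<^sub>M (\<nu> \<Otimes>\<^sub>M M))"
    unfolding G_def by (rule measurable_extend_by_zero[OF f])
  have I[measurable]: "{0<..t} \<times> UNIV \<in> sets (lborel \<Otimes>\<^sub>M \<nu>)"
    by (intro pair_measureI) (auto simp: sets_intensity)
  have "(\<lambda>(\<omega>, y). indicator ({0<..t} \<times> UNIV) y *\<^sub>R f (fst y, snd y, \<omega>)) =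
      (\<lambda>(\<omega>, y). indicator ({0<..t} \<times> UNIV) y *\<^sub>R G (fst y, snd y, \<omega>))"
    using t by (auto simp: G_def indicator_def fun_eq_iff)
  also have "\<dots> \<in> borel_measurable (M \<Otimes>\<^sub>M (lborel \<Otimes>\<^sub>M \<nu>))" by measurable
  finally show ?thesis .
qed

lemma drift_integral:
  fixes f :: "real \<times> 'z \<times> 'w \<Rightarrow> 'b::{banach,second_countable_topology}"
  assumes f: "f \<in> borel_measurable predictable" and t: "t \<le> T"
  defines "I \<equiv> \<lambda>\<omega>. LINT (s, z):{0<..t} \<times> UNIV|lborel \<Otimes>\<^sub>M \<nu>. f (s, z, \<omega>)"
  shows "I \<in> borel_measurable M"
    and "\<omega> \<in> space M \<Longrightarrow> ennreal (norm (I \<omega>)) \<le> compensator (\<lambda>x. ennreal (norm (f x))) \<omega>"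
proof -
  interpret N: finite_measure \<nu> by (rule finite_intensity)
  interpret LN: pair_sigma_finite "lborel :: real measure" \<nu> ..
  have LN: "sigma_finite_measure (lborel \<Otimes>\<^sub>M \<nu> :: (real \<times> 'z) measure)" by unfold_locales
  have I: "I \<omega> = (LINT y|(lborel \<Otimes>\<^sub>M \<nu>). indicator ({0<..t} \<times> UNIV) y *\<^sub>R f (fst y, snd y, \<omega>))" for \<omega>
    unfolding I_def set_lebesgue_integral_def by (simp add: split_def)
  show "I \<in> borel_measurable M"
    unfolding I[abs_def]
    by (rule sigma_finite_measure.borel_measurable_lebesgue_integral[OF LN integrand_section_measurable[OF f t]])
  assume \<omega>: "\<omega> \<in> space M"
  define g where "g x = (if fst x \<in> {0..T} then f x else 0)" for x
  have "g \<in> borel_measurable (lborel \<Otimes>\<^sub>M (\<nu> \<Otimes>\<^sub>M M))"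
    unfolding g_def[abs_def] by (rule measurable_extend_by_zero[OF f])
  moreover have "(\<lambda>y. (fst y, snd y, \<omega>)) \<in> measurable (lborel \<Otimes>\<^sub>M \<nu>) (lborel \<Otimes>\<^sub>M (\<nu> \<Otimes>\<^sub>M M))"
    by (intro measurable_Pair measurable_fst measurable_snd measurable_const \<omega>)
  ultimately have "(\<lambda>y. g (fst y, snd y, \<omega>)) \<in> borel_measurable (lborel \<Otimes>\<^sub>M \<nu>)"
    by (rule measurable_compose[rotated])
  then have m: "(\<lambda>y. ennreal (norm (g (fst y, snd y, \<omega>)))) \<in> borel_measurable (lborel \<Otimes>\<^sub>M \<nu>)" by measurable
  have "ennreal (norm (I \<omega>)) \<le>
      (\<integral>\<^sup>+y. ennreal (norm (indicator ({0<..t} \<times> UNIV) y *\<^sub>R f (fst y, snd y, \<omega>))) \<partial>(lborel \<Otimes>\<^sub>M \<nu>))"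
    unfolding I by (rule norm_integral_le_nn_integral)
  also have "\<dots> \<le> (\<integral>\<^sup>+y. ennreal (norm (g (fst y, snd y, \<omega>))) \<partial>(lborel \<Otimes>\<^sub>M \<nu>))"
    using t by (intro nn_integral_mono) (auto simp: g_def indicator_def)
  also have "\<dots> = (\<integral>\<^sup>+s. (\<integral>\<^sup>+z. ennreal (norm (g (s, z, \<omega>))) \<partial>\<nu>) \<partial>lborel)"
    using N.nn_integral_fst[OF m] by simp
  also have "\<dots> = (\<integral>\<^sup>+s\<in>{0..T}. (\<integral>\<^sup>+z. ennreal (norm (f (s, z, \<omega>))) \<partial>\<nu>) \<partial>lborel)"
  proof (rule nn_integral_cong)
    fix s
    show "(\<integral>\<^sup>+z. ennreal (norm (g (s, z, \<omega>))) \<partial>\<nu>) =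
        (\<integral>\<^sup>+z. ennreal (norm (f (s, z, \<omega>))) \<partial>\<nu>) * indicator {0..T} s"
      by (cases "s \<in> {0..T}") (simp_all only: g_def fst_conv if_True if_False indicator_simps, simp_all)
  qed
  also have "\<dots> = compensator (\<lambda>x. ennreal (norm (f x))) \<omega>"
    using f \<omega> by (intro compensator_eq_iterated[symmetric]) measurable
  finally show "ennreal (norm (I \<omega>)) \<le> compensator (\<lambda>x. ennreal (norm (f x))) \<omega>" .
qed

definition stopped :: "real \<Rightarrow> (real \<times> 'z \<times> 'w \<Rightarrow> 'b::real_vector) \<Rightarrow> real \<times> 'z \<times> 'w \<Rightarrow> 'b" where
  "stopped t f x = indicator {0<..t} (fst x) *\<^sub>R f x"

lemma stopped_measurable:
  fixes f :: "real \<times> 'z \<times> 'w \<Rightarrow> 'b::{banach,second_countable_topology}"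
  assumes f: "f \<in> borel_measurable predictable"
  shows "stopped t f \<in> borel_measurable predictable"
proof -
  have "(fst :: real \<times> 'z \<times> 'w \<Rightarrow> real) \<in> borel_measurable predictable"
    by (rule left_continuous_adapted_predictable) (simp add: left_continuous_adapted_def)
  then have "(\<lambda>x :: real \<times> 'z \<times> 'w. indicator {0<..t} (fst x) :: real) \<in> borel_measurable predictable"
    by (rule measurable_compose) simp
  then show ?thesis unfolding stopped_def[abs_def] using f by (rule borel_measurable_scaleR)
qed

lemma norm_jump_sum_stopped_le:
  fixes f :: "real \<times> 'z \<times> 'w \<Rightarrow> 'b::{banach,second_countable_topology}"
  shows "ennreal (norm (jump_sum (stopped t f) \<omega>)) \<le> jump_sum (\<lambda>x. ennreal (norm (f x))) \<omega>"
proof -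
  have "norm (jump_sum (stopped t f) \<omega>) \<le> (\<Sum>s\<in>D \<omega>. norm (f (s, q \<omega> s, \<omega>)))"
    unfolding jump_sum_def stopped_def by (rule sum_norm_le) (simp add: indicator_def)
  then have "ennreal (norm (jump_sum (stopped t f) \<omega>)) \<le> ennreal (\<Sum>s\<in>D \<omega>. norm (f (s, q \<omega> s, \<omega>)))"
    by (rule ennreal_leI)
  then show ?thesis by (simp add: jump_sum_def sum_ennreal)
qed

text \<open>An integral against a counting measure with finitely many relevant atoms is a finite sum. Beyond \<open>T\<close>
  there may be infinitely many jumps, but there the integrand vanishes.\<close>

lemma N_integral_eq_jump_sum:
  fixes f :: "real \<times> 'z \<times> 'w \<Rightarrow> 'b::{banach,second_countable_topology}"
  assumes f: "f \<in> borel_measurable predictable" and t: "t \<le> T" and \<omega>: "\<omega> \<in> space M"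
    and D: "D \<omega> = dom (p \<omega>) \<inter> {0<..T}" and q: "\<And>s. q \<omega> s = the (p \<omega> s)"
  shows "N_integral p f t \<omega> = jump_sum (stopped t f) \<omega>"
proof -
  let ?g = "\<lambda>y. indicator ({0<..t} \<times> UNIV) y *\<^sub>R f (fst y, snd y, \<omega>)"
  have "?g \<in> borel_measurable (lborel \<Otimes>\<^sub>M \<nu>)"
    using measurable_compose[OF measurable_Pair1'[OF \<omega>] integrand_section_measurable[OF f t]] by simp
  then have g: "?g \<in> borel_measurable (borel \<Otimes>\<^sub>M borel)"
    by (simp cong: measurable_cong_sets add: sets_pair_measure_cong[OF sets_lborel sets_intensity])
  have "N_integral p f t \<omega> = (LINT y|(count_measure p \<omega>). ?g y)"
    unfolding N_integral_def set_lebesgue_integral_def by (simp add: split_def)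
  also have "\<dots> = (LINT s|(count_space (dom (p \<omega>))). ?g (s, the (p \<omega> s)))"
    unfolding count_measure_def by (rule integral_distr[OF _ g]) (simp add: space_pair_measure)
  also have "\<dots> = (\<Sum>s | s \<in> dom (p \<omega>) \<and> ?g (s, the (p \<omega> s)) \<noteq> 0. ?g (s, the (p \<omega> s)))"
    by (rule lebesgue_integral_count_space_finite_support, rule finite_subset[OF _ finite_jumps[of \<omega>]])
      (use t in \<open>auto simp: D indicator_def split: if_splits\<close>)
  also have "\<dots> = (\<Sum>s\<in>D \<omega>. ?g (s, the (p \<omega> s)))"
    using finite_jumps[of \<omega>] t by (intro sum.mono_neutral_left) (auto simp: D indicator_def split: if_splits)
  also have "\<dots> = jump_sum (stopped t f) \<omega>"
    unfolding jump_sum_def stopped_def by (intro sum.cong) (auto simp: q indicator_def)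
  finally show ?thesis .
qed

end

section \<open>Set-valued integrals against a Poisson point process\<close>

text \<open>A measurable member \<open>g0\<close> of \<open>\<Gamma>\<close> is needed: without one, both sides of the
  characterisation of \<open>J\<close> could be empty, which would say nothing about the size of \<open>J\<close>. It is integrable
  because it is dominated by \<open>R \<le> 1 + R\<^sup>2\<close>.\<close>

lemma L2_integrably_bounded_of_decomposable:
  fixes \<Gamma> :: "('w \<Rightarrow> 'x::{banach,second_countable_topology}) set"
  assumes M: "prob_space M" and sub: "subalgebra M G" and J: "set_measurable G J"
    and sel: "selections1 M G J = L1_closure M (decomposable_hull G \<Gamma>)"
    and R: "R \<in> borel_measurable M" "(\<integral>\<^sup>+\<omega>. (R \<omega>)\<^sup>2 \<partial>M) < \<infinity>"
    and bound: "\<And>g. g \<in> \<Gamma> \<Longrightarrow> AE \<omega> in M. ennreal (norm (g \<omega>)) \<le> R \<omega>"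
    and g0: "g0 \<in> \<Gamma>" "g0 \<in> borel_measurable M"
  shows "L2_integrably_bounded M J"
proof -
  interpret prob_space M by fact
  have sp: "space G = space M" using sub by (simp add: subalgebra_def)
  have int: "integrable M g0"
  proof (rule integrableI_bounded[OF g0(2)])
    have le: "y \<le> 1 + y\<^sup>2" for y :: ennreal
    proof (cases "y \<le> 1")
      case True
      then show ?thesis by (simp add: add_increasing2)
    next
      case False
      then have "1 * y \<le> y * y" by (intro mult_right_mono) auto
      then show ?thesis by (simp add: power2_eq_square add_increasing)
    qed
    have "(\<integral>\<^sup>+\<omega>. ennreal (norm (g0 \<omega>)) \<partial>M) \<le> (\<integral>\<^sup>+\<omega>. 1 + (R \<omega>)\<^sup>2 \<partial>M)"
    proof (rule nn_integral_mono_AE)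
      show "AE \<omega> in M. ennreal (norm (g0 \<omega>)) \<le> 1 + (R \<omega>)\<^sup>2"
        using bound[OF g0(1)]
      proof eventually_elim
        case (elim \<omega>)
        then show ?case using le[of "R \<omega>"] by (rule order_trans)
      qed
    qed
    also have "\<dots> = 1 + (\<integral>\<^sup>+\<omega>. (R \<omega>)\<^sup>2 \<partial>M)"
      using R(1) by (subst nn_integral_add) (auto simp: emeasure_space_1)
    also have "\<dots> < \<infinity>" using R(2) by simp
    finally show "(\<integral>\<^sup>+\<omega>. ennreal (norm (g0 \<omega>)) \<partial>M) < \<infinity>" .
  qed
  define h where "h \<omega> = (\<Sum>i=1..1::nat. indicator (space G) \<omega> *\<^sub>R g0 \<omega>)" for \<omega>
  have h_hull: "h \<in> decomposable_hull G \<Gamma>"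
    unfolding decomposable_hull_def h_def[abs_def]
    by (intro CollectI exI[of _ "1::nat"] exI[of _ "\<lambda>_. space G"] exI[of _ "\<lambda>_. g0"] conjI refl)
      (use g0 in \<open>auto simp: disjoint_family_on_def\<close>)
  have "integrable M h \<longleftrightarrow> integrable M g0"
    by (rule Bochner_Integration.integrable_cong) (simp_all add: h_def sp)
  with int have "integrable M h" by simp
  then have "h \<in> L1_closure M (decomposable_hull G \<Gamma>)"
    unfolding L1_closure_def using h_hull by (auto intro!: bexI[of _ h])
  then have h_sel: "h \<in> selections1 M G J" by (simp add: sel)
  have le: "AE \<omega> in M. normK (J \<omega>) \<le> R \<omega>"
  proof (rule normK_bound_of_selections[OF M sub J h_sel])
    fix j assume "j \<in> selections1 M G J"
    then have "j \<in> L1_closure M (decomposable_hull G \<Gamma>)" by (simp add: sel)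
    from L1_closure_bound[OF R(1) decomposable_hull_bound[OF sp bound] this]
    show "AE \<omega> in M. ennreal (norm (j \<omega>)) \<le> R \<omega>" .
  qed
  have "(\<integral>\<^sup>+\<omega>. (normK (J \<omega>))\<^sup>2 \<partial>M) \<le> (\<integral>\<^sup>+\<omega>. (R \<omega>)\<^sup>2 \<partial>M)"
  proof (rule nn_integral_mono_AE)
    show "AE \<omega> in M. (normK (J \<omega>))\<^sup>2 \<le> (R \<omega>)\<^sup>2"
      using le by eventually_elim (simp add: power_mono)
  qed
  also have "\<dots> < \<infinity>" by (rule R)
  finally show ?thesis
    unfolding L2_integrably_bounded_def
    using measurable_from_subalg[OF sub normK_measurable[OF J]] by simp
qed

lemma (in complete_measure) measurable_of_AE_eq:
  assumes g: "g \<in> measurable M N" and eq: "AE x in M. f x = g x" and f: "f \<in> space M \<rightarrow> space N"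
  shows "f \<in> measurable M N"
proof (rule measurableI)
  fix A assume A: "A \<in> sets N"
  have gA: "g -` A \<inter> space M \<in> sets M" using g A by (rule measurable_sets)
  have "AE x in M. x \<in> g -` A \<inter> space M \<longleftrightarrow> x \<in> f -` A \<inter> space M"
    using eq by eventually_elim simp
  then show "f -` A \<inter> space M \<in> sets M" using gA by (rule in_sets_AE) simp
next
  show "f x \<in> space N" if "x \<in> space M" for x using f that by blast
qed

lemma integrand_selections_nonempty:
  fixes F :: "real \<times> 'z::second_countable_topology \<times> 'w \<Rightarrow> 'x::{banach,second_countable_topology} set"
  assumes \<nu>: "sets \<nu> = sets borel" and F: "F \<in> set_integrands M \<F> \<nu> T"
  obtains f where "f \<in> integrand_selections M \<F> \<nu> T F"
proof -
  let ?P = "pred_sigma TYPE('x) M \<F> T :: (real \<times> 'z \<times> 'w) measure"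
  have sp: "space ?P = {0..T} \<times> UNIV \<times> space M" unfolding pred_sigma_def by (rule space_measure_of) auto
  have "set_measurable ?P F" using F by (simp add: set_integrands_def)
  then obtain f where f: "f \<in> borel_measurable ?P" "\<And>x. x \<in> space ?P \<Longrightarrow> f x \<in> F x"
    by (rule Kuratowski_Ryll_Nardzewski) blast
  have "sq_energy M \<nu> T (\<lambda>x. ennreal (norm (f x))) \<le> sq_energy M \<nu> T (\<lambda>x. normK (F x))"
    unfolding sq_energy_def
  proof (intro nn_integral_mono)
    fix \<omega> t assume "\<omega> \<in> space M"
    then have "(\<integral>\<^sup>+z. (ennreal (norm (f (t, z, \<omega>))))\<^sup>2 \<partial>\<nu>) \<le> (\<integral>\<^sup>+z. (normK (F (t, z, \<omega>)))\<^sup>2 \<partial>\<nu>)"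
      if "t \<in> {0..T}"
      using that f(2) by (intro nn_integral_mono power_mono normK_upper) (auto simp: sp)
    then show "(\<integral>\<^sup>+z. (ennreal (norm (f (t, z, \<omega>))))\<^sup>2 \<partial>\<nu>) * indicator {0..T} t \<le>
        (\<integral>\<^sup>+z. (normK (F (t, z, \<omega>)))\<^sup>2 \<partial>\<nu>) * indicator {0..T} t"
      by (cases "t \<in> {0..T}") simp_all
  qed
  also have "\<dots> < \<infinity>" using F by (simp add: set_integrands_def)
  finally have "f \<in> integrands M \<F> \<nu> T" using f(1) by (simp add: integrands_def)
  moreover have "AE x in restrict_space lborel {0..T} \<Otimes>\<^sub>M (\<nu> \<Otimes>\<^sub>M M). f x \<in> F x"
    using f(2) sets_eq_imp_space_eq[OF \<nu>]
    by (intro AE_I2) (auto simp: sp space_pair_measure space_restrict_space)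
  ultimately show ?thesis by (intro that) (simp add: integrand_selections_def)
qed

lemma emeasure_count_measure:
  fixes p :: "'w \<Rightarrow> real \<rightharpoonup> 'z::second_countable_topology"
  assumes "A \<in> sets (borel \<Otimes>\<^sub>M borel)"
  shows "emeasure (count_measure p \<omega>) A =
    emeasure (count_space (dom (p \<omega>))) {s\<in>dom (p \<omega>). (s, the (p \<omega> s)) \<in> A}"
  unfolding count_measure_def using assms
  by (subst emeasure_distr) (auto simp: space_pair_measure intro!: arg_cong2[where f=emeasure])

text \<open>Paths with infinitely many points up to \<open>T\<close> form a null set and are given no points at all.\<close>

definition jump_times :: "('w \<Rightarrow> real \<rightharpoonup> 'z) \<Rightarrow> real \<Rightarrow> 'w \<Rightarrow> real set" where
  "jump_times p T \<omega> = (if finite (dom (p \<omega>) \<inter> {0<..T}) then dom (p \<omega>) \<inter> {0<..T} else {})"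

definition mark :: "('w \<Rightarrow> real \<rightharpoonup> 'z) \<Rightarrow> 'w \<Rightarrow> real \<Rightarrow> 'z" where
  "mark p \<omega> s = the (p \<omega> s)"

lemma emeasure_count_eq_card:
  fixes p :: "'w \<Rightarrow> real \<rightharpoonup> 'z::second_countable_topology"
  assumes fin: "finite (dom (p \<omega>) \<inter> {0<..T})" and t: "t \<le> T" and U: "U \<in> sets borel"
  shows "emeasure (count_measure p \<omega>) ({0<..t} \<times> U) =
    of_nat (card {s\<in>jump_times p T \<omega>. s \<le> t \<and> mark p \<omega> s \<in> U})"
proof -
  have eq: "{s\<in>dom (p \<omega>). (s, the (p \<omega> s)) \<in> {0<..t} \<times> U} =
      {s\<in>jump_times p T \<omega>. s \<le> t \<and> mark p \<omega> s \<in> U}"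
    using t fin by (auto simp: jump_times_def mark_def)
  have "{0<..t} \<times> U \<in> sets (borel \<Otimes>\<^sub>M borel)" using U by (intro pair_measureI) auto
  then have "emeasure (count_measure p \<omega>) ({0<..t} \<times> U) =
      emeasure (count_space (dom (p \<omega>))) {s\<in>jump_times p T \<omega>. s \<le> t \<and> mark p \<omega> s \<in> U}"
    unfolding eq[symmetric] by (rule emeasure_count_measure)
  also have "\<dots> = of_nat (card {s\<in>jump_times p T \<omega>. s \<le> t \<and> mark p \<omega> s \<in> U})"
  proof (rule emeasure_count_space_finite)
    show sub: "{s\<in>jump_times p T \<omega>. s \<le> t \<and> mark p \<omega> s \<in> U} \<subseteq> dom (p \<omega>)"
      by (auto simp: jump_times_def split: if_splits)
    show "finite {s\<in>jump_times p T \<omega>. s \<le> t \<and> mark p \<omega> s \<in> U}"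
      by (rule finite_subset[OF _ fin]) (auto simp: jump_times_def split: if_splits)
  qed
  finally show ?thesis .
qed

text \<open>The Poisson probabilities of the finite counts \<open>0, 1, 2, \<dots>\<close> add up to \<open>1\<close>. The martingale property could
  not give this, as an infinite count enters \<^const>\<open>compensated\<close> with the value \<open>0\<close>.\<close>

lemma AE_finite_jumps:
  fixes p :: "'w \<Rightarrow> real \<rightharpoonup> 'z::second_countable_topology"
  assumes M: "prob_space M" and \<nu>: "finite_measure \<nu>" "sets \<nu> = sets borel" and T: "0 < T"
    and P: "poisson_random_measure M (lborel \<Otimes>\<^sub>M \<nu>) (count_measure p) ({0<..} \<times> UNIV)"
  shows "AE \<omega> in M. finite (dom (p \<omega>) \<inter> {0<..T})"
proof -
  interpret prob_space M by fact
  interpret N: finite_measure \<nu> by fact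
  let ?B = "{0<..T} \<times> (UNIV :: 'z set)"
  let ?\<mu> = "lborel \<Otimes>\<^sub>M \<nu>"
  have B: "?B \<in> sets ?\<mu>" "?B \<subseteq> {0<..} \<times> UNIV" using \<nu>(2) by (auto intro!: pair_measureI)
  have "emeasure ?\<mu> ?B = ennreal T * emeasure \<nu> UNIV"
    using T \<nu>(2) by (subst N.emeasure_pair_measure_Times) auto
  then have fin: "emeasure ?\<mu> ?B < \<infinity>" by (simp add: N.emeasure_eq_measure ennreal_mult_less_top)
  have meas[measurable]: "(\<lambda>\<omega>. emeasure (count_measure p \<omega>) ?B) \<in> borel_measurable M"
    and prob: "\<And>k::nat. measure M {\<omega>\<in>space M. emeasure (count_measure p \<omega>) ?B = of_nat k} =
        measure ?\<mu> ?B ^ k / fact k * exp (- measure ?\<mu> ?B)"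
    using P B fin unfolding poisson_random_measure_def by blast+
  let ?A = "\<lambda>k::nat. {\<omega>\<in>space M. emeasure (count_measure p \<omega>) ?B = of_nat k}"
  have A: "range ?A \<subseteq> sets M" by auto
  have "(\<lambda>k. measure M (?A k)) sums measure M (\<Union>k. ?A k)"
    by (rule finite_measure_UNION[OF A]) (auto simp: disjoint_family_on_def)
  moreover have "(\<lambda>k. measure M (?A k)) sums (exp (measure ?\<mu> ?B) * exp (- measure ?\<mu> ?B))"
    unfolding prob using exp_converges[of "measure ?\<mu> ?B"] by (intro sums_mult2) (simp add: field_simps)
  ultimately have "measure M (\<Union>k. ?A k) = 1" by (simp add: sums_unique2 exp_minus_inverse)
  then have "AE \<omega> in M. \<omega> \<in> (\<Union>k. ?A k)" using A by (intro AE_prob_1)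
  then show ?thesis
  proof eventually_elim
    case (elim \<omega>)
    then have "emeasure (count_measure p \<omega>) ?B \<noteq> \<infinity>" by (auto simp: of_nat_less_top less_imp_neq)
    moreover have "?B \<in> sets (borel \<Otimes>\<^sub>M borel)" by (intro pair_measureI) auto
    ultimately have "emeasure (count_space (dom (p \<omega>))) {s\<in>dom (p \<omega>). (s, the (p \<omega> s)) \<in> ?B} \<noteq> \<infinity>"
      by (simp add: emeasure_count_measure)
    moreover have "{s\<in>dom (p \<omega>). (s, the (p \<omega> s)) \<in> ?B} = dom (p \<omega>) \<inter> {0<..T}" by auto
    ultimately show ?case
      by (metis (no_types, lifting) Int_lower1 emeasure_count_space_infinite)
  qed
qed

text \<open>Discarding the points of the exceptional paths preserves adaptedness, since the
  filtration contains all null sets from time \<open>0\<close> on.\<close>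

lemma marked_jumps_of_poisson_process:
  fixes p :: "'w \<Rightarrow> real \<rightharpoonup> 'z::{banach,second_countable_topology}"
  assumes usual: "usual_filtered_prob_space M \<F>"
    and \<nu>: "finite_measure \<nu>" "sets \<nu> = sets borel" and T: "0 < T"
    and p: "stationary_poisson_point_process M \<F> \<nu> p"
    and mart: "\<forall>U\<in>sets borel. martingale_on M {0..T} \<F> (compensated p \<nu> U)"
  shows "marked_jumps M \<F> \<nu> T (jump_times p T) (mark p)"
proof -
  interpret usual_filtered_prob_space M \<F> by fact
  interpret N: finite_measure \<nu> by fact
  let ?good = "\<lambda>\<omega>. finite (dom (p \<omega>) \<inter> {0<..T})"
  let ?n = "\<lambda>t U \<omega>. real (card {s\<in>jump_times p T \<omega>. s \<le> t \<and> mark p \<omega> s \<in> U})"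
  have P: "poisson_random_measure M (lborel \<Otimes>\<^sub>M \<nu>) (count_measure p) ({0<..} \<times> UNIV)"
    and adapted: "\<And>t U. 0 \<le> t \<Longrightarrow> U \<in> sets borel \<Longrightarrow>
      (\<lambda>\<omega>. emeasure (count_measure p \<omega>) ({0<..t} \<times> U)) \<in> borel_measurable (\<F> t)"
    using p unfolding stationary_poisson_point_process_def by blast+
  have good: "AE \<omega> in M. ?good \<omega>" by (rule AE_finite_jumps[OF prob_space_axioms \<nu> T P])
  have bad: "{\<omega>\<in>space M. \<not> ?good \<omega>} \<in> null_sets M" using good by (simp add: AE_iff_null_sets)
  have space: "space (\<F> t) = space M" and mono: "sets (\<F> 0) \<subseteq> sets (\<F> t)" if "0 \<le> t" for t
    using filtration that by (auto simp: filtration_on_def subalgebra_def)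
  have n_eq: "?n t U \<omega> = measure (count_measure p \<omega>) ({0<..t} \<times> U)"
    if "?good \<omega>" "t \<le> T" "U \<in> sets borel" for \<omega> t U
    using emeasure_count_eq_card[where p=p and \<omega>=\<omega> and T=T and t=t and U=U, OF that] by (simp add: measure_def enn2real_of_nat)
  show ?thesis
  proof (intro marked_jumps.intro marked_jumps_axioms.intro, fact prob_space_axioms, fact filtration,
      fact \<nu>(1), fact \<nu>(2), fact T)
    show "finite (jump_times p T \<omega>)" "jump_times p T \<omega> \<subseteq> {0<..T}" for \<omega>
      by (auto simp: jump_times_def)
  next
    fix t and U :: "'z set" assume t: "0 \<le> t" "t \<le> T" and U: "U \<in> sets borel"
    have "{\<omega>\<in>space M. \<not> ?good \<omega>} \<in> sets (\<F> t)" using bad null_sets_initial mono[OF t(1)] by blast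
    then have "space (\<F> t) - {\<omega>\<in>space M. \<not> ?good \<omega>} \<in> sets (\<F> t)" by (rule sets.compl_sets)
    also have "space (\<F> t) - {\<omega>\<in>space M. \<not> ?good \<omega>} = {\<omega>\<in>space (\<F> t). ?good \<omega>}" using space[OF t(1)] by auto
    finally have G: "{\<omega>\<in>space (\<F> t). ?good \<omega>} \<in> sets (\<F> t)" .
    have "?n t U \<omega> = (if ?good \<omega> then enn2real (emeasure (count_measure p \<omega>) ({0<..t} \<times> U)) else 0)" for \<omega>
      using n_eq[of \<omega> t U] t U by (auto simp: measure_def jump_times_def)
    moreover have "(\<lambda>\<omega>. if ?good \<omega> then enn2real (emeasure (count_measure p \<omega>) ({0<..t} \<times> U)) else 0)
        \<in> borel_measurable (\<F> t)"
      using adapted[OF t(1) U] G by (intro measurable_If measurable_compose[OF _ borel_measurable_enn2real]) auto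
    ultimately show "?n t U \<in> borel_measurable (\<F> t)" by simp
  next
    fix a b and U :: "'z set" and B assume ab: "0 \<le> a" "a \<le> b" "b \<le> T" and U: "U \<in> sets borel" and B: "B \<in> sets (\<F> a)"
    let ?X = "compensated p \<nu> U"
    let ?m = "\<lambda>\<omega>. real (card {s\<in>jump_times p T \<omega>. a < s \<and> s \<le> b \<and> mark p \<omega> s \<in> U})"
    have BM: "B \<in> sets M" using B ab filtration by (auto simp: filtration_on_def subalgebra_def)
    have X: "integrable M (?X a)" "integrable M (?X b)" "(LINT \<omega>:B|M. ?X b \<omega>) = (LINT \<omega>:B|M. ?X a \<omega>)"
      using mart U ab B unfolding martingale_on_def by auto
    have m: "?m \<omega> = (?X b \<omega> - ?X a \<omega>) + (b - a) * measure \<nu> U" if "?good \<omega>" for \<omega>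
    proof -
      have fin: "finite (jump_times p T \<omega>)" by (simp add: jump_times_def)
      have "card {s\<in>jump_times p T \<omega>. s \<le> b \<and> mark p \<omega> s \<in> U} =
          card ({s\<in>jump_times p T \<omega>. s \<le> a \<and> mark p \<omega> s \<in> U} \<union>
            {s\<in>jump_times p T \<omega>. a < s \<and> s \<le> b \<and> mark p \<omega> s \<in> U})"
        using ab by (intro arg_cong[where f=card]) auto
      also have "\<dots> = card {s\<in>jump_times p T \<omega>. s \<le> a \<and> mark p \<omega> s \<in> U} +
          card {s\<in>jump_times p T \<omega>. a < s \<and> s \<le> b \<and> mark p \<omega> s \<in> U}"
        using fin by (intro card_Un_disjoint) auto
      finally have "?n b U \<omega> = ?n a U \<omega> + ?m \<omega>" by simp
      then show ?thesis
        using n_eq[of \<omega> a U] n_eq[of \<omega> b U] that ab U by (simp add: compensated_def algebra_simps)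
    qed
    let ?Y = "\<lambda>\<omega>. ((?X b \<omega> - ?X a \<omega>) + (b - a) * measure \<nu> U) * indicator B \<omega>"
    have Y: "integrable M ?Y" using X BM by (intro integrable_real_mult_indicator) auto
    have Yeq: "AE \<omega> in M. ?m \<omega> * indicator B \<omega> = ?Y \<omega>" using good by eventually_elim (simp add: m)
    have nn: "AE \<omega> in M. 0 \<le> ?Y \<omega>"
      using Yeq
    proof eventually_elim
      case (elim \<omega>)
      have "0 \<le> ?m \<omega> * indicator B \<omega>" by simp
      then show ?case unfolding elim .
    qed
    have XB: "integrable M (\<lambda>\<omega>. indicator B \<omega> *\<^sub>R ?X a \<omega>)" "integrable M (\<lambda>\<omega>. indicator B \<omega> *\<^sub>R ?X b \<omega>)"
      using integrable_mult_indicator[OF BM X(1)] integrable_mult_indicator[OF BM X(2)] .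
    have "(\<integral>\<^sup>+\<omega>. ennreal (?m \<omega>) * indicator B \<omega> \<partial>M) = (\<integral>\<^sup>+\<omega>. ennreal (?Y \<omega>) \<partial>M)"
      by (rule nn_integral_cong_AE) (use Yeq in \<open>eventually_elim, auto simp: indicator_def\<close>)
    also have "\<dots> = ennreal (\<integral>\<omega>. ?Y \<omega> \<partial>M)" by (rule nn_integral_eq_integral[OF Y nn])
    also have "(\<integral>\<omega>. ?Y \<omega> \<partial>M) =
        (\<integral>\<omega>. (indicator B \<omega> *\<^sub>R ?X b \<omega> - indicator B \<omega> *\<^sub>R ?X a \<omega>) + ((b - a) * measure \<nu> U) * indicator B \<omega> \<partial>M)"
      by (intro Bochner_Integration.integral_cong) (auto simp: indicator_def)
    also have "\<dots> = (b - a) * measure \<nu> U * measure M B"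
    proof -
      have iB: "integrable M (\<lambda>\<omega>. ((b - a) * measure \<nu> U) * indicator B \<omega>)"
        using BM by (intro integrable_mult_right integrable_real_indicator) (auto simp: emeasure_eq_measure)
      show ?thesis
        unfolding Bochner_Integration.integral_add[OF Bochner_Integration.integrable_diff[OF XB(2,1)] iB]
          Bochner_Integration.integral_diff[OF XB(2,1)]
        using X(3) BM by (simp add: set_lebesgue_integral_def)
    qed
    also have "ennreal \<dots> = ennreal (b - a) * emeasure \<nu> U * emeasure M B"
      using ab by (simp add: N.emeasure_eq_measure emeasure_eq_measure ennreal_mult)
    finally show "(\<integral>\<^sup>+\<omega>. ennreal (?m \<omega>) * indicator B \<omega> \<partial>M) = ennreal (b - a) * emeasure \<nu> U * emeasure M B" .
  qed
qed

theorem theorem3p6: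
  fixes M :: "'w measure"
    and \<F> :: "real \<Rightarrow> 'w measure"
    and \<nu> :: "'z::{banach,second_countable_topology} measure"
    and p :: "'w \<Rightarrow> real \<rightharpoonup> 'z"
    and T :: real
    and F :: "real \<times> 'z \<times> 'w \<Rightarrow> 'x::{banach,second_countable_topology} set"
  assumes "usual_filtered_prob_space M \<F>"
    and "M_type_2 TYPE('x)"
    and "finite_measure \<nu>" and "sets \<nu> = sets borel"
    and "0 < T"
    and "stationary_poisson_point_process M \<F> \<nu> p"
    and "\<forall>U\<in>sets borel. martingale_on M {0..T} \<F> (compensated p \<nu> U)"
    and "F \<in> set_integrands M \<F> \<nu> T"
  shows "\<forall>t\<in>{0..T}.
     (\<forall>J. is_J M \<F> \<nu> T p F t J \<longrightarrow> L2_integrably_bounded M J) \<and>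
     (\<forall>I. is_I M \<F> \<nu> T p F t I \<longrightarrow> L2_integrably_bounded M I)"
proof -
  interpret usual_filtered_prob_space M \<F> by fact
  interpret marked_jumps M \<F> \<nu> T "jump_times p T" "mark p"
    by (rule marked_jumps_of_poisson_process) fact+
  have good: "AE \<omega> in M. finite (dom (p \<omega>) \<inter> {0<..T})"
    using assms(6) by (intro AE_finite_jumps[OF prob_space_axioms assms(3-5)])
      (simp add: stationary_poisson_point_process_def)
  define \<phi> where "\<phi> x = normK (F x)" for x
  have \<phi>: "\<phi> \<in> borel_measurable predictable"
    using assms(8) unfolding \<phi>_def[abs_def]
    by (intro pred_sigma_measurable[where 'b='x] normK_measurable) (simp add: set_integrands_def)
  then have \<phi>2: "(\<lambda>x. (\<phi> x)\<^sup>2) \<in> borel_measurable predictable" by measurable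
  have "(\<integral>\<^sup>+x. (\<phi> x)\<^sup>2 \<partial>intensity) = (\<integral>\<^sup>+\<omega>. compensator (\<lambda>x. (\<phi> x)\<^sup>2) \<omega> \<partial>M)"
    by (rule compensator_measurable_integral(2)[OF \<phi>2, symmetric])
  also have "\<dots> = sq_energy M \<nu> T (\<lambda>x. normK (F x))"
    unfolding sq_energy_def \<phi>_def[symmetric]
    by (intro nn_integral_cong) (rule compensator_eq_iterated[OF \<phi>2])
  also have "\<dots> < \<infinity>" using assms(8) by (simp add: set_integrands_def)
  finally have energy: "(\<integral>\<^sup>+x. (\<phi> x)\<^sup>2 \<partial>intensity) < \<infinity>" .
  define R where "R \<omega> = jump_sum \<phi> \<omega> + compensator \<phi> \<omega>" for \<omega>
  have R: "R \<in> borel_measurable M" "(\<integral>\<^sup>+\<omega>. (R \<omega>)\<^sup>2 \<partial>M) < \<infinity>"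
    using Campbell[OF \<phi>] compensator_measurable_integral(1)[OF \<phi>] dominating_variable_L2[OF \<phi> energy]
    unfolding R_def[abs_def] by (auto intro: borel_measurable_add)
  have predictable: "f \<in> borel_measurable predictable"
    and dominated: "AE \<omega> in M. jump_sum (\<lambda>x. ennreal (norm (f x))) \<omega> \<le> jump_sum \<phi> \<omega> \<and>
      compensator (\<lambda>x. ennreal (norm (f x))) \<omega> \<le> compensator \<phi> \<omega>"
    if f: "f \<in> integrand_selections M \<F> \<nu> T F" for f
  proof -
    show pf: "f \<in> borel_measurable predictable"
      using f by (intro pred_sigma_measurable[where 'b='x]) (simp add: integrand_selections_def integrands_def)
    have "AE x in intensity. f x \<in> F x" using f unfolding intensity_def integrand_selections_def by simp
    then have "AE x in intensity. ennreal (norm (f x)) \<le> \<phi> x"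
      by eventually_elim (simp add: \<phi>_def normK_upper)
    with pf \<phi> show "AE \<omega> in M. jump_sum (\<lambda>x. ennreal (norm (f x))) \<omega> \<le> jump_sum \<phi> \<omega> \<and>
        compensator (\<lambda>x. ennreal (norm (f x))) \<omega> \<le> compensator \<phi> \<omega>"
      by (intro domination_transfer) measurable
  qed
  obtain f0 where f0: "f0 \<in> integrand_selections M \<F> \<nu> T F"
    using integrand_selections_nonempty[OF assms(4,8)] .
  show ?thesis
  proof (intro ballI conjI allI impI)
    fix t J assume t: "t \<in> {0..T}"
    have sub: "subalgebra M (\<F> t)" using subalgebra_filtration t by simp
    define drift where "drift f \<omega> = (LINT (s, z):{0<..t} \<times> UNIV|lborel \<Otimes>\<^sub>M \<nu>. f (s, z, \<omega>))" for f :: "real \<times> 'z \<times> 'w \<Rightarrow> 'x" and \<omega>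
    have sum_eq: "AE \<omega> in M. N_integral p f t \<omega> = jump_sum (stopped t f) \<omega>"
      if "f \<in> integrand_selections M \<F> \<nu> T F" for f
      using good AE_space
    proof eventually_elim
      case (elim \<omega>)
      then show ?case
        using t by (intro N_integral_eq_jump_sum[OF predictable[OF that]]) (auto simp: jump_times_def mark_def)
    qed
    have drift_meas: "drift f \<in> borel_measurable M"
      and drift_le: "\<And>\<omega>. \<omega> \<in> space M \<Longrightarrow> ennreal (norm (drift f \<omega>)) \<le> compensator (\<lambda>x. ennreal (norm (f x))) \<omega>"
      if "f \<in> integrand_selections M \<F> \<nu> T F" for f
      using drift_integral[OF predictable[OF that], of t] t unfolding drift_def[abs_def] by auto
    have N_le: "AE \<omega> in M. ennreal (norm (N_integral p f t \<omega>)) \<le> jump_sum \<phi> \<omega>"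
      if f: "f \<in> integrand_selections M \<F> \<nu> T F" for f
      using sum_eq[OF f] dominated[OF f]
      by eventually_elim (use norm_jump_sum_stopped_le in \<open>auto intro: order_trans\<close>)
    have N_meas: "N_integral p f0 t \<in> borel_measurable M"
      by (rule measurable_of_AE_eq[OF jump_sum_measurable[OF stopped_measurable[OF predictable[OF f0]]] sum_eq[OF f0]]) simp
    have comp: "N_comp_integral p \<nu> f t \<omega> = N_integral p f t \<omega> - drift f \<omega>" for f :: "real \<times> 'z \<times> 'w \<Rightarrow> 'x" and \<omega>
      by (simp add: N_comp_integral_def drift_def)
    {
      assume J: "is_J M \<F> \<nu> T p F t J"
      show "L2_integrably_bounded M J"
      proof (rule L2_integrably_bounded_of_decomposable[OF prob_space_axioms sub _ _ R])
        show "set_measurable (\<F> t) J"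
          "selections1 M (\<F> t) J = L1_closure M (decomposable_hull (\<F> t)
            ((\<lambda>f. N_integral p f t) ` integrand_selections M \<F> \<nu> T F))"
          using J by (auto simp: is_J_def)
        show "N_integral p f0 t \<in> (\<lambda>f. N_integral p f t) ` integrand_selections M \<F> \<nu> T F" using f0 by blast
      next
        fix g assume "g \<in> (\<lambda>f. N_integral p f t) ` integrand_selections M \<F> \<nu> T F"
        then obtain f where f: "f \<in> integrand_selections M \<F> \<nu> T F" "g = N_integral p f t" by blast
        show "AE \<omega> in M. ennreal (norm (g \<omega>)) \<le> R \<omega>"
          using N_le[OF f(1)] by eventually_elim (simp add: f(2) R_def add_increasing2)
      qed (rule N_meas)
    next
      assume J: "is_I M \<F> \<nu> T p F t J"
      show "L2_integrably_bounded M J"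
      proof (rule L2_integrably_bounded_of_decomposable[OF prob_space_axioms sub _ _ R])
        show "set_measurable (\<F> t) J"
          "selections1 M (\<F> t) J = L1_closure M (decomposable_hull (\<F> t)
            ((\<lambda>f. N_comp_integral p \<nu> f t) ` integrand_selections M \<F> \<nu> T F))"
          using J by (auto simp: is_I_def)
        show "N_comp_integral p \<nu> f0 t \<in> (\<lambda>f. N_comp_integral p \<nu> f t) ` integrand_selections M \<F> \<nu> T F"
          using f0 by blast
        show "N_comp_integral p \<nu> f0 t \<in> borel_measurable M"
          unfolding comp[abs_def] using N_meas drift_meas[OF f0] by (rule borel_measurable_diff)
      next
        fix g assume "g \<in> (\<lambda>f. N_comp_integral p \<nu> f t) ` integrand_selections M \<F> \<nu> T F"
        then obtain f where f: "f \<in> integrand_selections M \<F> \<nu> T F" "g = N_comp_integral p \<nu> f t" by blast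
        show "AE \<omega> in M. ennreal (norm (g \<omega>)) \<le> R \<omega>"
          using N_le[OF f(1)] dominated[OF f(1)] AE_space
        proof eventually_elim
          case (elim \<omega>)
          have "ennreal (norm (g \<omega>)) \<le> ennreal (norm (N_integral p f t \<omega>)) + ennreal (norm (drift f \<omega>))"
            unfolding f(2) comp by (simp add: ennreal_leI norm_triangle_ineq4 flip: ennreal_plus)
          also have "\<dots> \<le> R \<omega>"
            unfolding R_def using elim drift_le[OF f(1), of \<omega>] by (intro add_mono) auto
          finally show ?case .
        qed
      qed
    }
  qed
qed

end
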